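(* Let $\Gamma$ be a finite connected simple graph and let $G(\Gamma)$ be the group defined below. Let $0\le \lambda<\frac12$ and let $N\ge \frac{2|V(\Gamma)|+1}{1-2\lambda}$. Let $h\in G(\Gamma)$ and suppose there are two $(\lambda,N)$-quasi-root decompositions $$h=a_1g_1^{n_1}b_1=a_2g_2^{n_2}b_2$$ such that $g_1$ and $g_2$ are strongly non-split and primitive. Then $g_1$ and $g_2$ are conjugate; more precisely $a_1g_1a_1^{-1}=a_2g_2a_2^{-1}$ and $b_1^{-1}g_1b_1=b_2^{-1}g_2b_2$.
   Context: For a finite simple graph $\Gamma$, $G(\Gamma)=\langle v\in V(\Gamma)\mid [v_i,v_j]=1 \text{ if } \{v_i,v_j\}\notin E(\Gamma)\rangle$ (i.e. generators commute exactly when NOT adjacent; $G(\Gamma)$ is the right-angled Artin group on the complement graph). $|g|$ denotes the word length of $g$ with respect to the generators $V(\Gamma)$; a word is reduced if it is a shortest word representing its element. The support $\mathrm{supp}(g)$ is the set of generators $v$ such that $v$ or $v^{-1}$ appears in a reduced word representing $g$ (well defined). Two elements $g_1,g_2$ disjointly commute if $\mathrm{supp}(g_1)\cap\mathrm{supp}(g_2)=\emptyset$ and every $v_1\in\mathrm{supp}(g_1)$ commutes with every $v_2\in\mathrm{supp}(g_2)$, i.e. $\{v_1,v_2\}\notin E(\Gamma)$. An element $g$ is non-split if $\mathrm{supp}(g)$ spans a connected subgraph of $\Gamma$, and strongly non-split if it is non-split and no generator $v\in V(\Gamma)$ disjointly commutes with $g$. A nontrivial element $g$ is primitive if $g\neq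 u^n$ for all $u\in G(\Gamma)$ and $n\ge 2$. A decomposition $g=g_1\cdots g_k$ is geodesic if $|g|=|g_1|+\cdots+|g_k|$. For $0\le\lambda<\frac12$ and $N\ge 2$, a $(\lambda,N)$-quasi-root decomposition of $h$ is a geodesic decomposition $h=a\cdot g\cdot g\cdots g\cdot b=ag^nb$ (with $n$ factors $g$, i.e. $|h|=|a|+n|g|+|b|$) for some $n\ge N$ and $a,b\in G(\Gamma)$ with $|a|,|b|\le\lambda|h|$; then $g$ is called a $(\lambda,N)$-quasi-root of $h$. *)

theory Defs
  imports Complex_Main
begin

(* Elements of G(Gamma) are represented by words: lists of letters (v, b),
   where (v, True) stands for v and (v, False) for v^-1.
   The graph Gamma has vertex set V and symmetric irreflexive edge relation E. *)

type_synonym 'a word = "('a \<times> bool) list"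

definition simple_graph :: "'a set \<Rightarrow> ('a \<Rightarrow> 'a \<Rightarrow> bool) \<Rightarrow> bool" where
  "simple_graph V E \<longleftrightarrow> finite V \<and> (\<forall>x y. E x y \<longrightarrow> x \<in> V \<and> y \<in> V)
     \<and> (\<forall>x y. E x y \<longrightarrow> E y x) \<and> (\<forall>x. \<not> E x x)"

definition connected_on :: "('a \<Rightarrow> 'a \<Rightarrow> bool) \<Rightarrow> 'a set \<Rightarrow> bool" where
  "connected_on E S \<longleftrightarrow> (\<forall>x\<in>S. \<forall>y\<in>S. (\<lambda>a b. E a b \<and> a \<in> S \<and> b \<in> S)\<^sup>*\<^sup>* x y)"

definition is_word :: "'a set \<Rightarrow> 'a word \<Rightarrow> bool" where
  "is_word V w \<longleftrightarrow> (\<forall>l\<in>set w. fst l \<in> V)"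

definition inv_word :: "'a word \<Rightarrow> 'a word" where
  "inv_word w = rev (map (\<lambda>(v, b). (v, \<not> b)) w)"

definition pow_word :: "'a word \<Rightarrow> nat \<Rightarrow> 'a word" where
  "pow_word w n = concat (replicate n w)"

inductive raag_step :: "('a \<Rightarrow> 'a \<Rightarrow> bool) \<Rightarrow> 'a word \<Rightarrow> 'a word \<Rightarrow> bool" for E where
  cancel: "raag_step E (xs @ [(v, b), (v, \<not> b)] @ ys) (xs @ ys)"
| swap: "u \<noteq> v \<Longrightarrow> \<not> E u v \<Longrightarrow>
     raag_step E (xs @ [(u, b), (v, c)] @ ys) (xs @ [(v, c), (u, b)] @ ys)"

definition raag_eq :: "('a \<Rightarrow> 'a \<Rightarrow> bool) \<Rightarrow> 'a word \<Rightarrow> 'a word \<Rightarrow> bool" where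
  "raag_eq E = (\<lambda>x y. raag_step E x y \<or> raag_step E y x)\<^sup>*\<^sup>*"

definition wlen :: "'a set \<Rightarrow> ('a \<Rightarrow> 'a \<Rightarrow> bool) \<Rightarrow> 'a word \<Rightarrow> nat" where
  "wlen V E w = (LEAST n. \<exists>w'. is_word V w' \<and> raag_eq E w w' \<and> length w' = n)"

definition reduced :: "'a set \<Rightarrow> ('a \<Rightarrow> 'a \<Rightarrow> bool) \<Rightarrow> 'a word \<Rightarrow> bool" where
  "reduced V E w \<longleftrightarrow> is_word V w \<and> length w = wlen V E w"

definition supp :: "'a set \<Rightarrow> ('a \<Rightarrow> 'a \<Rightarrow> bool) \<Rightarrow> 'a word \<Rightarrow> 'a set" where
  "supp V E g = {v. \<exists>w. raag_eq E g w \<and> reduced V E w \<and> v \<in> fst ` set w}"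

definition disj_commute :: "'a set \<Rightarrow> ('a \<Rightarrow> 'a \<Rightarrow> bool) \<Rightarrow> 'a word \<Rightarrow> 'a word \<Rightarrow> bool" where
  "disj_commute V E g1 g2 \<longleftrightarrow> supp V E g1 \<inter> supp V E g2 = {}
     \<and> (\<forall>v1\<in>supp V E g1. \<forall>v2\<in>supp V E g2. \<not> E v1 v2)"

definition non_split :: "'a set \<Rightarrow> ('a \<Rightarrow> 'a \<Rightarrow> bool) \<Rightarrow> 'a word \<Rightarrow> bool" where
  "non_split V E g \<longleftrightarrow> connected_on E (supp V E g)"

definition strongly_non_split :: "'a set \<Rightarrow> ('a \<Rightarrow> 'a \<Rightarrow> bool) \<Rightarrow> 'a word \<Rightarrow> bool" where
  "strongly_non_split V E g \<longleftrightarrow> non_split V E g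
     \<and> (\<forall>v\<in>V. \<not> disj_commute V E [(v, True)] g)"

definition primitive :: "'a set \<Rightarrow> ('a \<Rightarrow> 'a \<Rightarrow> bool) \<Rightarrow> 'a word \<Rightarrow> bool" where
  "primitive V E g \<longleftrightarrow> \<not> raag_eq E g []
     \<and> (\<forall>u n. is_word V u \<and> n \<ge> 2 \<longrightarrow> \<not> raag_eq E g (pow_word u n))"

definition quasi_root_decomp ::
  "'a set \<Rightarrow> ('a \<Rightarrow> 'a \<Rightarrow> bool) \<Rightarrow> real \<Rightarrow> nat \<Rightarrow> 'a word \<Rightarrow> 'a word \<Rightarrow> 'a word \<Rightarrow> nat \<Rightarrow> 'a word \<Rightarrow> bool" where
  "quasi_root_decomp V E lam N h a g n b \<longleftrightarrow>
     0 \<le> lam \<and> lam < 1/2 \<and> N \<ge> 2 \<and> n \<ge> N \<and>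
     is_word V a \<and> is_word V g \<and> is_word V b \<and>
     raag_eq E h (a @ pow_word g n @ b) \<and>
     wlen V E h = wlen V E a + n * wlen V E g + wlen V E b \<and>
     real (wlen V E a) \<le> lam * real (wlen V E h) \<and>
     real (wlen V E b) \<le> lam * real (wlen V E h)"

end

theory Submission
  imports Defs "HOL-Library.Sublist" "HOL-Library.Multiset"
begin

text \<open>
  Reduced words of one element differ only by commutations, so the two decompositions of \<open>h\<close> are
  equal traces, where a trace is determined by its projections to pairs of dependent vertices and a
  prefix of a given trace by its number of occurrences of each vertex. Write \<open>d = card V - 1\<close>. As
  the support of \<open>g\<^sub>1\<close> is connected and dominating, every prefix of \<open>h\<close> either lies in
  \<open>a\<^sub>1 g\<^sub>1 ^ i\<close> or contains \<open>a\<^sub>1 g\<^sub>1 ^ (i - d)\<close>; the same holds for \<open>g\<^sub>2\<close>. The length hypothesis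
  then yields some \<open>j\<close> such that \<open>a\<^sub>2 g\<^sub>2 ^ j = a\<^sub>1 c\<close> lies deep inside both powers. There
  \<open>g = c\<inverse> g\<^sub>1 c\<close> is a positive trace, and both \<open>a\<^sub>1 c g g\<^sub>2\<close> and \<open>a\<^sub>1 c g\<^sub>2 g\<close> are prefixes of \<open>h\<close>
  with the same numbers of occurrences, so \<open>g\<close> and \<open>g\<^sub>2\<close> commute. Commuting traces of connected
  dominating support are powers of a common trace, and primitivity gives \<open>g = g\<^sub>2\<close>.
\<close>

section \<open>Projections and letter counts of words\<close>

definition proj :: "'a \<Rightarrow> 'a \<Rightarrow> 'a word \<Rightarrow> 'a word" where
  "proj u v = filter (\<lambda>l. fst l = u \<or> fst l = v)"

text \<open>Both signs of a vertex are counted, so this is an invariant of traces but not of group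
  elements.\<close>

definition cnt :: "'a \<Rightarrow> 'a word \<Rightarrow> nat" where
  "cnt v w = length (proj v v w)"

definition flip :: "'a \<times> bool \<Rightarrow> 'a \<times> bool" where
  "flip l = (fst l, \<not> snd l)"

lemma flip_simps [simp]: "flip (flip l) = l" "fst (flip l) = fst l" "flip l \<noteq> l"
  by (auto simp: flip_def prod_eq_iff)

lemma proj_simps [simp]:
  "proj u v [] = []" "proj u v (xs @ ys) = proj u v xs @ proj u v ys"
  "proj u v (l # xs) = (if fst l = u \<or> fst l = v then l # proj u v xs else proj u v xs)"
  by (auto simp: proj_def)

lemma set_proj: "set (proj u v w) = {l \<in> set w. fst l = u \<or> fst l = v}"
  by (auto simp: proj_def)

lemma cnt_simps [simp]:
  "cnt v [] = 0" "cnt v (xs @ ys) = cnt v xs + cnt v ys"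
  by (auto simp: cnt_def)

lemma cnt_Cons: "cnt v (l # xs) = (if fst l = v then 1 else 0) + cnt v xs"
  by (auto simp: cnt_def)

lemma cnt_pos_iff: "0 < cnt v w \<longleftrightarrow> v \<in> fst ` set w"
  by (induction w) (auto simp: cnt_Cons)

lemma length_proj: "u \<noteq> v \<Longrightarrow> length (proj u v w) = cnt u w + cnt v w"
  by (induction w) (auto simp: cnt_Cons)

lemma cnt_proj: "cnt u (proj u v w) = cnt u w" "cnt v (proj u v w) = cnt v w"
  by (induction w) (auto simp: cnt_Cons)

lemma length_eq_sum_cnt:
  assumes "finite V" and "is_word V w"
  shows "length w = (\<Sum>v\<in>V. cnt v w)"
  using assms(2)
  by (induction w) (auto simp: cnt_Cons is_word_def sum.distrib assms(1))

lemma pow_word_simps [simp]: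
  "pow_word w 0 = []" "pow_word w (Suc n) = w @ pow_word w n"
  by (auto simp: pow_word_def)

lemma pow_word_add: "pow_word w (m + n) = pow_word w m @ pow_word w n"
  by (induction m) auto

lemma pow_word_comm: "pow_word w n @ w = w @ pow_word w n"
  by (induction n) auto

lemma length_pow_word [simp]: "length (pow_word w n) = n * length w"
  by (induction n) auto

lemma cnt_pow_word [simp]: "cnt v (pow_word w n) = n * cnt v w"
  by (induction n) auto

lemma is_word_simps [simp]:
  "is_word V []" "is_word V (xs @ ys) \<longleftrightarrow> is_word V xs \<and> is_word V ys"
  "is_word V (l # xs) \<longleftrightarrow> fst l \<in> V \<and> is_word V xs"
  by (auto simp: is_word_def)

lemma is_word_pow_word: "is_word V w \<Longrightarrow> is_word V (pow_word w n)"
  by (induction n) auto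

lemma is_word_inv_word [simp]: "is_word V (inv_word w) \<longleftrightarrow> is_word V w"
  by (auto simp: is_word_def inv_word_def)

lemma inv_word_simps [simp]: "inv_word [] = []" "inv_word (l # w) = inv_word w @ [flip l]"
  by (auto simp: inv_word_def flip_def split: prod.splits)

locale raag_graph =
  fixes V :: "'a set" and E :: "'a \<Rightarrow> 'a \<Rightarrow> bool"
  assumes graph: "simple_graph V E"
begin

lemma E_sym: "E u v \<Longrightarrow> E v u" and finite_V: "finite V"
  using graph by (auto simp: simple_graph_def)

section \<open>The group\<close>

abbreviation geq (infix "\<approx>" 50) where "x \<approx> y \<equiv> raag_eq E x y"

lemma geq_refl [simp]: "x \<approx> x"
  by (simp add: raag_eq_def)

lemma geq_trans [trans]: "x \<approx> y \<Longrightarrow> y \<approx> z \<Longrightarrow> x \<approx> z"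
  by (auto simp: raag_eq_def)

lemma geq_sym: "x \<approx> y \<Longrightarrow> y \<approx> x"
  unfolding raag_eq_def
  by (rule sympD[OF symp_rtranclp]) (auto simp: symp_def)

lemma raag_step_context: "raag_step E x y \<Longrightarrow> raag_step E (a @ x @ b) (a @ y @ b)"
proof (induction rule: raag_step.induct)
  case (cancel xs v c ys)
  show ?case using raag_step.cancel[of E "a @ xs" v c "ys @ b"] by simp
next
  case (swap u v xs c d ys)
  then show ?case using raag_step.swap[of u v E "a @ xs" c d "ys @ b"] by simp
qed

lemma geq_context: "x \<approx> y \<Longrightarrow> a @ x @ b \<approx> a @ y @ b"
  unfolding raag_eq_def
proof (induction rule: rtranclp_induct)
  case (step y z)
  then have "raag_step E (a @ y @ b) (a @ z @ b) \<or> raag_step E (a @ z @ b) (a @ y @ b)"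
    using raag_step_context by blast
  with step.IH show ?case by (rule rtranclp.rtrancl_into_rtrancl)
qed simp

lemma geq_append:
  assumes "x \<approx> x'" and "y \<approx> y'"
  shows "x @ y \<approx> x' @ y'"
proof -
  have "[] @ x @ y \<approx> [] @ x' @ y" using assms(1) by (rule geq_context)
  also have "\<dots> = x' @ y @ []" by simp
  also have "\<dots> \<approx> x' @ y' @ []" using assms(2) by (rule geq_context)
  finally show ?thesis by simp
qed

lemma geq_Cons: "x \<approx> y \<Longrightarrow> l # x \<approx> l # y"
  using geq_append[of "[l]" "[l]" x y] by simp

lemma geq_flip: "l # flip l # w \<approx> w"
  using raag_step.cancel[of E "[]" "fst l" "snd l" w]
  by (auto simp: raag_eq_def flip_def)

lemma geq_swap:
  assumes "fst l \<noteq> fst m" and "\<not> E (fst l) (fst m)"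
  shows "l # m # w \<approx> m # l # w"
  using raag_step.swap[of "fst l" "fst m" E "[]" "snd l" "snd m" w] assms
  by (auto simp: raag_eq_def)

lemma geq_inv_right: "w @ inv_word w \<approx> []"
proof (induction w)
  case (Cons l w)
  have "l # (w @ inv_word w) @ [flip l] \<approx> l # [] @ [flip l]"
    using Cons by (intro geq_Cons geq_append) auto
  also have "\<dots> \<approx> []" using geq_flip[of l "[]"] by simp
  finally show ?case by simp
qed simp

lemma geq_inv_left: "inv_word w @ w \<approx> []"
proof (induction w)
  case (Cons l w)
  have "inv_word w @ (flip l # flip (flip l) # w) \<approx> inv_word w @ w"
    by (intro geq_append geq_flip) simp
  then show ?case using Cons geq_trans by fastforce
qed simp

lemma geq_cancel_right: assumes "x @ z \<approx> y @ z" shows "x \<approx> y"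
proof -
  have e: "u \<approx> u @ z @ inv_word z" for u
    using geq_append[OF geq_refl[of u] geq_inv_right[of z]] geq_sym by simp
  have "x \<approx> (x @ z) @ inv_word z" using e[of x] by simp
  also have "\<dots> \<approx> (y @ z) @ inv_word z" by (rule geq_append[OF assms geq_refl])
  also have "\<dots> \<approx> y" using e[of y] geq_sym by simp
  finally show ?thesis .
qed

lemma geq_cancel_left: assumes "z @ x \<approx> z @ y" shows "x \<approx> y"
proof -
  have e: "u \<approx> inv_word z @ z @ u" for u
    using geq_append[OF geq_inv_left[of z] geq_refl[of u]] geq_sym by simp
  have "x \<approx> inv_word z @ (z @ x)" by (rule e)
  also have "\<dots> \<approx> inv_word z @ (z @ y)" by (rule geq_append[OF geq_refl assms])
  also have "\<dots> \<approx> y" using e[of y] geq_sym by simp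
  finally show ?thesis .
qed

lemma geq_pow_word: "x \<approx> y \<Longrightarrow> pow_word x n \<approx> pow_word y n"
  by (induction n) (auto intro: geq_append)

lemma geq_conj_right: "(a @ g @ inv_word a) @ a \<approx> a @ g"
  using geq_append[OF geq_refl[of "a @ g"] geq_inv_left[of a]] by simp

lemma geq_conj_left: "b @ inv_word b @ g @ b \<approx> g @ b"
  using geq_append[OF geq_inv_right[of b] geq_refl[of "g @ b"]] by simp

lemma geq_conj_pow_word: "pow_word (c @ t @ inv_word c) n @ c \<approx> c @ pow_word t n"
proof (induction n)
  case (Suc n)
  have "(c @ t @ inv_word c) @ (pow_word (c @ t @ inv_word c) n @ c)
     \<approx> (c @ t @ inv_word c) @ (c @ pow_word t n)"
    using Suc by (intro geq_append[OF geq_refl])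
  also have "\<dots> \<approx> (c @ t) @ pow_word t n"
    using geq_append[OF geq_conj_right[of c t] geq_refl[of "pow_word t n"]] by simp
  finally show ?case by simp
qed simp

section \<open>Trace equivalence\<close>

text \<open>Equality in the trace monoid on signed letters, where letters are dependent when their
  vertices are equal or adjacent; \<open>v\<close> and its inverse are merely two dependent letters.
  The encoding by projections makes cancellation and counting immediate.\<close>

definition teq :: "'a word \<Rightarrow> 'a word \<Rightarrow> bool" (infix "\<equiv>\<^sub>t" 50) where
  "x \<equiv>\<^sub>t y \<longleftrightarrow> (\<forall>u v. u = v \<or> E u v \<longrightarrow> proj u v x = proj u v y)"

definition tprefix :: "'a word \<Rightarrow> 'a word \<Rightarrow> bool" where
  "tprefix x y \<longleftrightarrow> (\<forall>u v. u = v \<or> E u v \<longrightarrow> prefix (proj u v x) (proj u v y))"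

definition indep :: "'a \<times> bool \<Rightarrow> 'a \<times> bool \<Rightarrow> bool" where
  "indep l m \<longleftrightarrow> fst l \<noteq> fst m \<and> \<not> E (fst l) (fst m)"

lemma indep_sym: "indep l m \<Longrightarrow> indep m l"
  using E_sym by (auto simp: indep_def)

lemma indep_flip [simp]: "indep (flip l) m = indep l m" "indep l (flip m) = indep l m"
  by (auto simp: indep_def)

lemma teq_refl [simp]: "x \<equiv>\<^sub>t x"
  by (simp add: teq_def)

lemma teq_trans [trans]: "x \<equiv>\<^sub>t y \<Longrightarrow> y \<equiv>\<^sub>t z \<Longrightarrow> x \<equiv>\<^sub>t z"
  by (simp add: teq_def)

lemma teq_sym: "x \<equiv>\<^sub>t y \<Longrightarrow> y \<equiv>\<^sub>t x"
  by (simp add: teq_def)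

lemma teq_append: "x \<equiv>\<^sub>t x' \<Longrightarrow> y \<equiv>\<^sub>t y' \<Longrightarrow> x @ y \<equiv>\<^sub>t x' @ y'"
  by (simp add: teq_def)

lemma teq_append_cancel [simp]:
  "z @ x \<equiv>\<^sub>t z @ y \<longleftrightarrow> x \<equiv>\<^sub>t y" "x @ z \<equiv>\<^sub>t y @ z \<longleftrightarrow> x \<equiv>\<^sub>t y"
  by (auto simp: teq_def)

lemma teq_Cons_cancel [simp]: "l # x \<equiv>\<^sub>t l # y \<longleftrightarrow> x \<equiv>\<^sub>t y"
  using teq_append_cancel(1)[of "[l]" x y] by simp

lemma teq_mset: assumes "x \<equiv>\<^sub>t y" shows "mset x = mset y"
proof (rule multiset_eqI)
  fix l
  have "count (mset w) l = count (mset (proj (fst l) (fst l) w)) l" for w :: "'a word"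
    by (induction w) auto
  then show "count (mset x) l = count (mset y) l"
    using assms by (metis teq_def)
qed

lemma teq_length: "x \<equiv>\<^sub>t y \<Longrightarrow> length x = length y"
  and teq_set: "x \<equiv>\<^sub>t y \<Longrightarrow> set x = set y"
  and teq_Nil_iff: "x \<equiv>\<^sub>t [] \<longleftrightarrow> x = []"
  by (auto dest: teq_mset mset_eq_length mset_eq_setD)

lemma teq_is_word: "x \<equiv>\<^sub>t y \<Longrightarrow> is_word V x \<longleftrightarrow> is_word V y"
  by (simp add: is_word_def teq_set)

lemma teq_cnt: "x \<equiv>\<^sub>t y \<Longrightarrow> cnt v x = cnt v y"
  by (simp add: cnt_def teq_def)

text \<open>A projection to a dependent pair that keeps \<open>l\<close> keeps no letter of
  \<open>s\<close>, so no projection sees \<open>l\<close> pass \<open>s\<close>.\<close>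

lemma teq_move_front:
  assumes "\<And>m. m \<in> set s \<Longrightarrow> indep l m"
  shows "s @ l # t \<equiv>\<^sub>t l # s @ t"
  unfolding teq_def
proof (intro allI impI)
  fix u v assume uv: "u = v \<or> E u v"
  have "proj u v s = []" if "fst l = u \<or> fst l = v"
  proof -
    have "\<not> (fst m = u \<or> fst m = v)" if "m \<in> set s" for m
      using assms[OF that] uv \<open>fst l = u \<or> fst l = v\<close> E_sym by (auto simp: indep_def)
    then show ?thesis by (auto simp: proj_def filter_empty_conv)
  qed
  then show "proj u v (s @ l # t) = proj u v (l # s @ t)"
    by auto
qed

lemma teq_swap: "indep l m \<Longrightarrow> l # m # w \<equiv>\<^sub>t m # l # w"
  using teq_move_front[of "[l]" m w] indep_sym[of l m] by simp

text \<open>The projection to \<open>fst l\<close> alone shows that the first occurrence of this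
  vertex in \<open>q\<close> is the letter \<open>l\<close>. The projection to an edge at
  \<open>fst l\<close> also starts with \<open>l\<close>, so no neighbour occurs earlier.\<close>

lemma tprefix_Cons_split:
  assumes "tprefix (l # p) q"
  obtains s t where "q = s @ l # t" "\<And>m. m \<in> set s \<Longrightarrow> indep l m" "tprefix p (s @ t)"
proof -
  let ?a = "fst l"
  have pr: "prefix (proj u v (l # p)) (proj u v q)" if "u = v \<or> E u v" for u v
    using assms that unfolding tprefix_def by blast
  have "prefix (l # proj ?a ?a p) (proj ?a ?a q)" using pr[of ?a ?a] by simp
  then have "l \<in> set (proj ?a ?a q)" by (auto simp: prefix_def)
  then have "\<exists>m\<in>set q. fst m = ?a" by (auto simp: set_proj)
  from split_list_first_prop[OF this]
  obtain s l' t where q: "q = s @ l' # t" "fst l' = ?a" "\<forall>m\<in>set s. fst m \<noteq> ?a"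
    by blast
  have "proj ?a ?a s = []" using q(3) by (auto simp: proj_def filter_empty_conv)
  with pr[of ?a ?a] q have l': "l' = l" by (auto simp: prefix_def)
  have ind: "indep l m" if m: "m \<in> set s" for m
  proof (rule ccontr)
    assume "\<not> indep l m"
    with m q(3) have "E ?a (fst m)" by (auto simp: indep_def)
    from pr[of ?a "fst m"] this have "prefix (l # proj ?a (fst m) p) (proj ?a (fst m) s @ proj ?a (fst m) (l' # t))"
      by (simp add: q(1))
    moreover have "m \<in> set (proj ?a (fst m) s)" using m by (simp add: set_proj)
    ultimately have "l \<in> set (proj ?a (fst m) s)"
      by (cases "proj ?a (fst m) s") auto
    then show False using q(3) by (auto simp: set_proj)
  qed
  have "q \<equiv>\<^sub>t l # s @ t" using teq_move_front[OF ind] q(1) l' by simp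
  then have pre: "prefix (proj u v (l # p)) (proj u v (l # s @ t))" if "u = v \<or> E u v" for u v
    using pr[OF that] that by (simp only: teq_def)
  have "prefix (proj u v p) (proj u v (s @ t))" if "u = v \<or> E u v" for u v
    using pre[OF that] by (simp split: if_splits)
  then have "tprefix p (s @ t)" by (simp add: tprefix_def)
  with q(1) l' ind that show ?thesis by blast
qed

lemma teq_Cons_split:
  assumes "l # w \<equiv>\<^sub>t q"
  obtains s t where "q = s @ l # t" "\<And>m. m \<in> set s \<Longrightarrow> indep l m" "w \<equiv>\<^sub>t s @ t"
proof -
  have "tprefix (l # w) q" using assms by (auto simp: tprefix_def teq_def simp del: proj_simps)
  then obtain s t where st: "q = s @ l # t" "\<And>m. m \<in> set s \<Longrightarrow> indep l m"
    by (rule tprefix_Cons_split) blast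
  have "s @ l # t \<equiv>\<^sub>t l # s @ t" by (rule teq_move_front[OF st(2)])
  then have "l # w \<equiv>\<^sub>t l # s @ t"
    using assms unfolding st(1) by (rule teq_trans[rotated])
  with st that show ?thesis by simp
qed

text \<open>Turns the condition on projections into left divisibility of traces, by bringing the
  letters of \<open>p\<close> to the front of \<open>q\<close> one at a time.\<close>

lemma tprefix_extend: "tprefix p q \<Longrightarrow> \<exists>e. q \<equiv>\<^sub>t p @ e"
proof (induction p arbitrary: q)
  case Nil
  show ?case using teq_refl[of q] by (intro exI[of _ q]) simp
next
  case (Cons l p)
  from Cons.prems obtain s t where q: "q = s @ l # t" "\<And>m. m \<in> set s \<Longrightarrow> indep l m"
    "tprefix p (s @ t)" by (rule tprefix_Cons_split) blast
  from Cons.IH[OF q(3)] obtain e where "s @ t \<equiv>\<^sub>t p @ e" ..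
  then have "l # s @ t \<equiv>\<^sub>t (l # p) @ e" by simp
  moreover have "q \<equiv>\<^sub>t l # s @ t" unfolding q(1) using q(2) by (rule teq_move_front)
  ultimately have "q \<equiv>\<^sub>t (l # p) @ e" using teq_trans by blast
  then show ?case ..
qed

lemma geq_move_front:
  "(\<And>m. m \<in> set s \<Longrightarrow> indep l m) \<Longrightarrow> s @ l # t \<approx> l # s @ t"
proof (induction s)
  case (Cons m s)
  have "m # (s @ l # t) \<approx> m # l # s @ t" using Cons by (intro geq_Cons) auto
  also have "\<dots> \<approx> l # m # s @ t"
    using indep_sym[OF Cons.prems[of m]] by (intro geq_swap) (auto simp: indep_def)
  finally show ?case by simp
qed simp

lemma teq_imp_geq: "x \<equiv>\<^sub>t y \<Longrightarrow> x \<approx> y"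
proof (induction x arbitrary: y)
  case Nil
  then show ?case using teq_Nil_iff[of y] teq_sym[of "[]" y] by simp
next
  case (Cons l x)
  from Cons.prems obtain s t where y: "y = s @ l # t" "\<And>m. m \<in> set s \<Longrightarrow> indep l m"
    "x \<equiv>\<^sub>t s @ t" by (rule teq_Cons_split) blast
  have "l # x \<approx> l # s @ t" using Cons.IH[OF y(3)] by (rule geq_Cons)
  also have "\<dots> \<approx> y" using geq_move_front[OF y(2)] y(1) geq_sym by simp
  finally show ?case .
qed

section \<open>Reduced words of the same element are trace equivalent\<close>

text \<open>If two different letters can both be brought to the front, one has to pass the other, so
  they are independent and both split off from a common rest.\<close>

lemma teq_Cons_Cons_diamond:
  assumes "l # w \<equiv>\<^sub>t m # w'" and "l \<noteq> m"
  obtains z where "indep l m" "w \<equiv>\<^sub>t m # z" "w' \<equiv>\<^sub>t l # z"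
proof -
  from assms(1) obtain s t where st: "m # w' = s @ l # t" "\<And>k. k \<in> set s \<Longrightarrow> indep l k"
    "w \<equiv>\<^sub>t s @ t" by (rule teq_Cons_split) blast
  with assms(2) obtain s' where s: "s = m # s'" by (cases s) auto
  then have "w' \<equiv>\<^sub>t l # s' @ t" using st teq_move_front[of s' l t] by simp
  with that[of "s' @ t"] st s show ?thesis by auto
qed

text \<open>
  The group acts on irreducible traces by left multiplication of letters, so evaluating a word on the
  empty trace gives a trace depending only on the element.
\<close>

definition starts :: "'a \<times> bool \<Rightarrow> 'a word \<Rightarrow> bool" where
  "starts l w \<longleftrightarrow> (\<exists>z. w \<equiv>\<^sub>t l # z)"

definition irr :: "'a word \<Rightarrow> bool" where
  "irr w \<longleftrightarrow> \<not> (\<exists>x l y. w \<equiv>\<^sub>t x @ l # flip l # y)"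

text \<open>The choice is harmless: by left cancellation the remainder \<open>z\<close> is unique up
  to \<open>teq\<close>. The operation is thus well defined on traces only.\<close>

definition lmult :: "'a \<times> bool \<Rightarrow> 'a word \<Rightarrow> 'a word" where
  "lmult l w = (if starts (flip l) w then SOME z. w \<equiv>\<^sub>t flip l # z else l # w)"

definition nf :: "'a word \<Rightarrow> 'a word" where
  "nf w = foldr lmult w []"

lemma nf_simps [simp]: "nf [] = []" "nf (l # w) = lmult l (nf w)"
  by (auto simp: nf_def)

lemma starts_cong: "w \<equiv>\<^sub>t w' \<Longrightarrow> starts l w \<longleftrightarrow> starts l w'"
  unfolding starts_def using teq_trans teq_sym by blast

lemma starts_indep: assumes "indep l m" shows "starts l (m # w) \<longleftrightarrow> starts l w"
proof
  assume "starts l (m # w)"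
  then obtain z where "m # w \<equiv>\<^sub>t l # z" by (auto simp: starts_def)
  moreover have "m \<noteq> l" using assms by (auto simp: indep_def)
  ultimately show "starts l w" by (metis teq_Cons_Cons_diamond starts_def)
next
  assume "starts l w"
  then obtain z where "w \<equiv>\<^sub>t l # z" by (auto simp: starts_def)
  then have "m # w \<equiv>\<^sub>t m # l # z" by simp
  also have "\<dots> \<equiv>\<^sub>t l # m # z" using indep_sym[OF assms] by (rule teq_swap)
  finally have "m # w \<equiv>\<^sub>t l # m # z" .
  then show "starts l (m # w)" by (auto simp: starts_def)
qed

lemma lmult_starts: "starts (flip l) w \<Longrightarrow> w \<equiv>\<^sub>t flip l # lmult l w"
  unfolding lmult_def starts_def by (auto intro: someI_ex)

lemma lmult_not_starts: "\<not> starts (flip l) w \<Longrightarrow> lmult l w = l # w"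
  by (simp add: lmult_def)

lemma lmult_eqI: "w \<equiv>\<^sub>t flip l # z \<Longrightarrow> lmult l w \<equiv>\<^sub>t z"
  using lmult_starts[of l w] teq_trans teq_sym teq_Cons_cancel starts_def by meson

lemma lmult_cong: assumes "w \<equiv>\<^sub>t w'" shows "lmult l w \<equiv>\<^sub>t lmult l w'"
proof (cases "starts (flip l) w'")
  case True
  then show ?thesis using lmult_starts assms teq_trans by (blast intro: lmult_eqI)
next
  case False
  then show ?thesis using assms starts_cong lmult_not_starts by simp
qed

lemma irr_lmult: assumes "irr w" shows "irr (lmult l w)"
proof (cases "starts (flip l) w")
  case True
  show ?thesis unfolding irr_def
  proof
    assume "\<exists>x k y. lmult l w \<equiv>\<^sub>t x @ k # flip k # y"
    then obtain x k y where "lmult l w \<equiv>\<^sub>t x @ k # flip k # y" by blast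
    then have "flip l # lmult l w \<equiv>\<^sub>t (flip l # x) @ k # flip k # y" by simp
    with lmult_starts[OF True] have "w \<equiv>\<^sub>t (flip l # x) @ k # flip k # y" by (rule teq_trans)
    then show False using assms unfolding irr_def by blast
  qed
next
  case False
  show ?thesis unfolding irr_def lmult_not_starts[OF False]
  proof
    assume "\<exists>x k y. l # w \<equiv>\<^sub>t x @ k # flip k # y"
    then obtain x k y where "l # w \<equiv>\<^sub>t x @ k # flip k # y" by blast
    then obtain s t where st: "x @ k # flip k # y = s @ l # t"
      "\<And>m. m \<in> set s \<Longrightarrow> indep l m" "w \<equiv>\<^sub>t s @ t" by (rule teq_Cons_split) blast
    have not_indep: "\<not> indep m m" "\<not> indep (flip m) m" for m by (auto simp: indep_def)
    \<comment> \<open>The letter \<open>l\<close> lies inside \<open>x\<close>, is \<open>k\<close>,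
      is \<open>flip k\<close>, or lies inside \<open>y\<close>. The outer cases leave the inverse
      pair in \<open>w\<close>, the second makes \<open>w\<close> start with \<open>flip l\<close>,
      and the third makes \<open>k\<close> independent of its own inverse.\<close>
    consider (x) x' where "x = s @ l # x'" "t = x' @ k # flip k # y"
      | (k) "s = x" "l = k" "t = flip k # y"
      | (flip) "s = x @ [k]" "l = flip k"
      | (y) y' where "s = x @ k # flip k # y'" "y = y' @ l # t"
      using st(1) by (auto simp: append_eq_append_conv2 append_eq_Cons_conv Cons_eq_append_conv)
    then show False
    proof cases
      case x
      then have "w \<equiv>\<^sub>t (s @ x') @ k # flip k # y" using st(3) by simp
      then show False using assms unfolding irr_def by blast
    next
      case k
      then have "w \<equiv>\<^sub>t x @ flip l # y" using st(3) by simp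
      also have "\<dots> \<equiv>\<^sub>t flip l # x @ y" using st(2) k by (intro teq_move_front) simp
      finally have "w \<equiv>\<^sub>t flip l # x @ y" .
      then show False using False by (auto simp: starts_def)
    next
      case flip
      then show False using st(2)[of k] not_indep by simp
    next
      case y
      then have "w \<equiv>\<^sub>t x @ k # flip k # (y' @ t)" using st(3) by simp
      then show False using assms unfolding irr_def by blast
    qed
  qed
qed

text \<open>If \<open>w\<close> starts with \<open>l\<close>, the outer multiplication has to put
  \<open>l\<close> back instead of cancelling once more. A remainder starting with
  \<open>flip l\<close> would exhibit an inverse pair in \<open>w\<close>, against
  irreducibility.\<close>

lemma lmult_flip: assumes "irr w" shows "lmult l (lmult (flip l) w) \<equiv>\<^sub>t w"
proof (cases "starts l w")
  case True
  let ?z = "lmult (flip l) w"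
  have z: "w \<equiv>\<^sub>t l # ?z" using lmult_starts[of "flip l" w] True by simp
  have "\<not> starts (flip l) ?z"
  proof
    assume "starts (flip l) ?z"
    then obtain y where "?z \<equiv>\<^sub>t flip l # y" by (auto simp: starts_def)
    then have "l # ?z \<equiv>\<^sub>t [] @ l # flip l # y" by simp
    with z have "w \<equiv>\<^sub>t [] @ l # flip l # y" by (rule teq_trans)
    then show False using assms unfolding irr_def by blast
  qed
  then show ?thesis using z teq_sym by (simp add: lmult_not_starts)
next
  case False
  then have "lmult (flip l) w = flip l # w" by (simp add: lmult_not_starts)
  then show ?thesis by (simp add: lmult_eqI)
qed

lemma lmult_commute_half:
  assumes "indep l m" and "starts (flip l) w" and "\<not> starts (flip m) w"
  shows "lmult l (lmult m w) \<equiv>\<^sub>t lmult m (lmult l w)"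
proof -
  let ?z = "lmult l w"
  have z: "w \<equiv>\<^sub>t flip l # ?z" using assms(2) by (rule lmult_starts)
  have "\<not> starts (flip m) ?z"
    using assms(3) starts_cong[OF z] starts_indep[of "flip m" "flip l" ?z] indep_sym[OF assms(1)]
    by simp
  then have r: "lmult m ?z = m # ?z" by (rule lmult_not_starts)
  have "m # w \<equiv>\<^sub>t m # flip l # ?z" using z by simp
  also have "\<dots> \<equiv>\<^sub>t flip l # m # ?z" using indep_sym[OF assms(1)] by (intro teq_swap) simp
  finally show ?thesis using r assms(3) by (simp add: lmult_not_starts lmult_eqI)
qed

text \<open>The cases are which of the two letters cancels against \<open>w\<close>. If both do, the
  diamond property gives the common rest; if one does, independence keeps the other from cancelling
  afterwards.\<close>

lemma lmult_commute: assumes "indep l m" shows "lmult l (lmult m w) \<equiv>\<^sub>t lmult m (lmult l w)"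
proof -
  have ml: "indep m l" using assms by (rule indep_sym)
  consider "starts (flip l) w" "\<not> starts (flip m) w" | "\<not> starts (flip l) w" "starts (flip m) w"
    | "starts (flip l) w" "starts (flip m) w" | "\<not> starts (flip l) w" "\<not> starts (flip m) w"
    by blast
  then show ?thesis
  proof cases
    case 1
    then show ?thesis using assms lmult_commute_half by blast
  next
    case 2
    then show ?thesis using ml lmult_commute_half teq_sym by blast
  next
    case 3
    have l: "w \<equiv>\<^sub>t flip l # lmult l w" and m: "w \<equiv>\<^sub>t flip m # lmult m w"
      using 3 lmult_starts by auto
    have "flip l # lmult l w \<equiv>\<^sub>t flip m # lmult m w" using l m teq_sym teq_trans by blast
    moreover have "flip l \<noteq> flip m" using assms by (auto simp: indep_def flip_def)
    ultimately obtain z where "lmult l w \<equiv>\<^sub>t flip m # z" "lmult m w \<equiv>\<^sub>t flip l # z"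
      by (rule teq_Cons_Cons_diamond)
    then show ?thesis using lmult_eqI teq_sym teq_trans by blast
  next
    case 4
    then have "\<not> starts (flip l) (m # w)" "\<not> starts (flip m) (l # w)"
      using starts_indep[of "flip l" m w] starts_indep[of "flip m" l w] assms ml by auto
    then show ?thesis using 4 teq_swap[OF assms] by (simp add: lmult_not_starts)
  qed
qed

lemma irr_nf: "irr (nf w)"
  by (induction w) (auto simp: irr_lmult, auto simp: irr_def dest!: teq_length)

lemma nf_append_cong: "nf x \<equiv>\<^sub>t nf y \<Longrightarrow> nf (w @ x) \<equiv>\<^sub>t nf (w @ y)"
  by (induction w) (auto intro: lmult_cong)

lemma nf_step: "raag_step E x y \<Longrightarrow> nf x \<equiv>\<^sub>t nf y"
proof (induction rule: raag_step.induct)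
  case (cancel xs v b ys)
  have "nf ([(v, b), (v, \<not> b)] @ ys) \<equiv>\<^sub>t nf ys"
    using lmult_flip[OF irr_nf, of "(v, b)" ys] by (simp add: flip_def)
  then show ?case by (rule nf_append_cong)
next
  case (swap u v xs b c ys)
  have "nf ([(u, b), (v, c)] @ ys) \<equiv>\<^sub>t nf ([(v, c), (u, b)] @ ys)"
    using lmult_commute[of "(u, b)" "(v, c)"] swap by (simp add: indep_def)
  then show ?case by (rule nf_append_cong)
qed

lemma geq_imp_nf: "x \<approx> y \<Longrightarrow> nf x \<equiv>\<^sub>t nf y"
  unfolding raag_eq_def
proof (induction rule: rtranclp_induct)
  case (step y z)
  then show ?case using nf_step teq_sym teq_trans by blast
qed simp

lemma geq_lmult: "lmult l w \<approx> l # w"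
proof (cases "starts (flip l) w")
  case True
  have "l # w \<approx> l # flip l # lmult l w"
    using teq_imp_geq[OF lmult_starts[OF True]] by (rule geq_Cons)
  also have "\<dots> \<approx> lmult l w" by (rule geq_flip)
  finally show ?thesis by (rule geq_sym)
qed (simp add: lmult_not_starts)

lemma geq_nf: "nf w \<approx> w"
proof (induction w)
  case (Cons l w)
  have "lmult l (nf w) \<approx> l # nf w" by (rule geq_lmult)
  also have "\<dots> \<approx> l # w" using Cons by (rule geq_Cons)
  finally show ?case by simp
qed simp

lemma set_lmult: "set (lmult l w) \<subseteq> insert l (set w)"
proof (cases "starts (flip l) w")
  case True
  then show ?thesis using teq_set[OF lmult_starts[OF True]] by auto
qed (simp add: lmult_not_starts)

lemma set_nf: "set (nf w) \<subseteq> set w"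
  using set_lmult by (induction w) fastforce+

lemma is_word_nf: "is_word V w \<Longrightarrow> is_word V (nf w)"
  using set_nf by (auto simp: is_word_def)

lemma length_lmult: "length (lmult l w) \<le> Suc (length w)"
  "length (lmult l w) = Suc (length w) \<Longrightarrow> lmult l w = l # w"
proof -
  have "length (lmult l w) < length w" if "starts (flip l) w"
    using teq_length[OF lmult_starts[OF that]] by simp
  then show "length (lmult l w) \<le> Suc (length w)"
    "length (lmult l w) = Suc (length w) \<Longrightarrow> lmult l w = l # w"
    using lmult_not_starts[of l w] by (cases "starts (flip l) w"; fastforce)+
qed

lemma length_nf: "length (nf w) \<le> length w"
proof (induction w)
  case (Cons l w)
  then show ?case using length_lmult(1)[of l "nf w"] by simp
qed simp

text \<open>A letter that cancels shortens the word, so full length means that \<open>lmult\<close>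
  only ever prepended. The equality is therefore literal and not just up to
  \<open>teq\<close>.\<close>

lemma nf_length_eq: "length (nf w) = length w \<Longrightarrow> nf w = w"
proof (induction w)
  case (Cons l w)
  have "length (lmult l (nf w)) = Suc (length (nf w))" "length (nf w) = length w"
    using Cons.prems length_lmult(1)[of l "nf w"] length_nf[of w] by auto
  then show ?case using Cons.IH length_lmult(2)[of l "nf w"] by simp
qed simp

section \<open>Word length, reduced words and supports\<close>

lemma wlen_le: "is_word V w' \<Longrightarrow> w \<approx> w' \<Longrightarrow> wlen V E w \<le> length w'"
  unfolding wlen_def by (rule Least_le) blast

lemma ex_reduced:
  assumes "is_word V w"
  obtains w' where "is_word V w'" "w \<approx> w'" "length w' = wlen V E w"
proof -
  have "\<exists>n w'. is_word V w' \<and> w \<approx> w' \<and> length w' = n" using assms geq_refl by blast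
  then have "\<exists>w'. is_word V w' \<and> w \<approx> w' \<and> length w' = wlen V E w"
    unfolding wlen_def by (rule LeastI_ex)
  then show ?thesis using that by blast
qed

lemma wlen_cong: assumes "x \<approx> y" shows "wlen V E x = wlen V E y"
proof -
  have "x \<approx> w \<longleftrightarrow> y \<approx> w" for w using assms geq_sym geq_trans by blast
  then show ?thesis by (simp add: wlen_def)
qed

text \<open>Minimal length excludes any shortening by \<open>nf\<close>, so \<open>w\<close> is its
  own normal form, and the normal form depends up to \<open>teq\<close> only on the group
  element.\<close>

lemma reduced_teq_nf: assumes "reduced V E w" and "w \<approx> g" shows "w \<equiv>\<^sub>t nf g"
proof -
  have w: "is_word V w" "length w = wlen V E w" using assms(1) by (auto simp: reduced_def)
  have "wlen V E w \<le> length (nf w)"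
    using w(1) geq_nf geq_sym by (intro wlen_le is_word_nf) auto
  then have "nf w = w" using w(2) length_nf[of w] by (intro nf_length_eq) simp
  then show ?thesis using geq_imp_nf[OF assms(2)] by simp
qed

lemma reduced_teq:
  assumes "reduced V E x" and "reduced V E y" and "x \<approx> y"
  shows "x \<equiv>\<^sub>t y"
  using assms reduced_teq_nf geq_refl teq_sym teq_trans by meson

lemma supp_subset: "supp V E g \<subseteq> fst ` set g"
proof
  fix v assume "v \<in> supp V E g"
  then obtain w where "g \<approx> w" "reduced V E w" "v \<in> fst ` set w" by (auto simp: supp_def)
  then have "v \<in> fst ` set (nf g)" using reduced_teq_nf[of w g] geq_sym teq_set by metis
  then show "v \<in> fst ` set g" using set_nf by fastforce
qed

lemma supp_reduced: assumes "reduced V E w" and "g \<approx> w" shows "supp V E g = fst ` set w"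
proof -
  have "g \<approx> x \<longleftrightarrow> w \<approx> x" for x using assms(2) geq_sym geq_trans by blast
  then have "supp V E g = supp V E w" by (simp add: supp_def)
  moreover have "fst ` set w \<subseteq> supp V E w" using assms(1) geq_refl[of w] unfolding supp_def by blast
  ultimately show ?thesis using supp_subset by blast
qed

section \<open>Prefixes of a trace\<close>

lemma teq_append_proj_prefix:
  "h \<equiv>\<^sub>t p @ r \<Longrightarrow> u = v \<or> E u v \<Longrightarrow> prefix (proj u v p) (proj u v h)"
  unfolding teq_def prefix_def by (metis proj_simps(2))

text \<open>In every projection \<open>p\<close> and \<open>q\<close> give prefixes of one word.
  These are comparable, and their lengths, which the counts determine, decide the order.\<close>

lemma tprefix_of_cnt_le:
  assumes "h \<equiv>\<^sub>t p @ r" and "h \<equiv>\<^sub>t q @ s" and "\<And>v. cnt v p \<le> cnt v q"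
  obtains e where "q \<equiv>\<^sub>t p @ e"
proof -
  have "prefix (proj u v p) (proj u v q)" if uv: "u = v \<or> E u v" for u v
  proof (rule prefix_length_prefix)
    show "prefix (proj u v p) (proj u v h)" "prefix (proj u v q) (proj u v h)"
      using assms(1,2) uv teq_append_proj_prefix by blast+
    show "length (proj u v p) \<le> length (proj u v q)"
      using assms(3)[of u] assms(3)[of v] by (cases "u = v") (auto simp: length_proj cnt_def)
  qed
  then have "tprefix p q" by (simp add: tprefix_def)
  then show ?thesis using tprefix_extend that by blast
qed

lemma teq_of_cnt_eq:
  assumes "p @ r \<equiv>\<^sub>t q @ s" and "\<And>v. cnt v p = cnt v q"
  shows "p \<equiv>\<^sub>t q"
proof -
  obtain e where e: "q \<equiv>\<^sub>t p @ e"
    using tprefix_of_cnt_le[of "p @ r" p r q s] assms by auto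
  have "cnt v e = 0" for v using teq_cnt[OF e, of v] assms(2)[of v] by simp
  then have "e = []" using cnt_pos_iff[of "fst (hd e)" e] by (cases e) auto
  then show ?thesis using e teq_sym by simp
qed

text \<open>The projections to the edge are prefixes of one word. Since that of \<open>p\<close> has
  fewer \<open>v\<close>, it is a prefix of that of \<open>q\<close> and has no more
  \<open>u\<close> either.\<close>

lemma cnt_le_of_dependent:
  assumes "h \<equiv>\<^sub>t p @ r" and "h \<equiv>\<^sub>t q @ s" and "E u v" and "cnt v p < cnt v q"
  shows "cnt u p \<le> cnt u q"
proof -
  have mono: "cnt x y \<le> cnt x z" if "prefix y z" for x and y z :: "'a word"
    using that by (auto simp: prefix_def)
  have "prefix (proj u v p) (proj u v h)" "prefix (proj u v q) (proj u v h)"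
    using assms(1-3) teq_append_proj_prefix by blast+
  then consider "prefix (proj u v p) (proj u v q)" | "prefix (proj u v q) (proj u v p)"
    using prefix_same_cases by blast
  then show ?thesis
  proof cases
    case 1
    then show ?thesis using mono[OF 1, of u] by (simp add: cnt_proj)
  next
    case 2
    then show ?thesis using mono[OF 2, of v] assms(4) by (simp add: cnt_proj)
  qed
qed

lemma connected_on_boundary:
  assumes "connected_on E S" and "B \<subseteq> S" and "B \<noteq> {}" and "B \<noteq> S"
  obtains v u where "v \<in> B" "u \<in> S - B" "E v u"
proof -
  obtain x y where x: "x \<in> B" and y: "y \<in> S - B" using assms by blast
  have "(\<lambda>a b. E a b \<and> a \<in> S \<and> b \<in> S)\<^sup>*\<^sup>* x y"
    using assms(1,2) x y by (auto simp: connected_on_def)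
  then have "y \<in> B \<or> (\<exists>v\<in>B. \<exists>u\<in>S - B. E v u)"
  proof (induction rule: rtranclp_induct)
    case base
    show ?case using x by simp
  next
    case (step y z)
    then show ?case by blast
  qed
  then show ?thesis using y that by blast
qed

text \<open>Until it fills \<open>S\<close>, each stage has an edge leaving it and the next stage
  gains a vertex, so stage \<open>k\<close> has more than \<open>k\<close> of them. This is the
  source of the delay \<open>card V - 1\<close> below.\<close>

lemma connected_on_exhaust:
  assumes "connected_on E S" and "finite S" and "\<And>m. B m \<subseteq> S" and "B 0 \<noteq> {}"
    and mono: "\<And>m. m < M \<Longrightarrow> B m \<subseteq> B (Suc m)"
    and grow: "\<And>m u v. m < M \<Longrightarrow> v \<in> B m \<Longrightarrow> u \<in> S \<Longrightarrow> E v u \<Longrightarrow> u \<in> B (Suc m)"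
    and "m \<le> M" and "card S \<le> Suc m"
  shows "B m = S"
proof -
  have fin: "finite (B k)" for k using assms(2,3) finite_subset by blast
  have "B k = S \<or> k < card (B k)" if "k \<le> M" for k
    using that
  proof (induction k)
    case 0
    show ?case using assms(4) fin[of 0] by (simp add: card_gt_0_iff)
  next
    case (Suc k)
    then have k: "k < M" by simp
    show ?case
    proof (cases "B k = S")
      case True
      then show ?thesis using mono[OF k] assms(3)[of "Suc k"] by blast
    next
      case False
      then have card: "k < card (B k)" using Suc by simp
      then have "B k \<noteq> {}" by auto
      then obtain v u where vu: "v \<in> B k" "u \<in> S - B k" "E v u"
        using connected_on_boundary[OF assms(1,3) _ False] by blast
      then have "insert u (B k) \<subseteq> B (Suc k)" using mono[OF k] grow[OF k] by blast
      then have "card (insert u (B k)) \<le> card (B (Suc k))" using fin by (intro card_mono)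
      then show ?thesis using card vu fin by simp
    qed
  qed
  then have "B m = S \<or> m < card (B m)" using assms(7) .
  then show ?thesis using card_seteq[OF assms(2) assms(3)[of m]] assms(8) by auto
qed

text \<open>The graph form of the second half of strong non-splitness: a vertex violating it would
  commute disjointly with any element of support \<open>S\<close>.\<close>

definition dominating :: "'a set \<Rightarrow> bool" where
  "dominating S \<longleftrightarrow> (\<forall>v\<in>V. v \<in> S \<or> (\<exists>u\<in>S. E v u))"

text \<open>
  An occurrence of a vertex in a block of \<open>g ^ n\<close> dominates all occurrences of its neighbours in the
  preceding blocks, so a prefix leaving \<open>a g ^ i\<close> has swallowed the whole support of \<open>g\<close> after going
  back at most \<open>card V - 1\<close> blocks, and then, since the support is dominating, all of \<open>a\<close> as well.
\<close>

lemma power_prefix_comparable: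
  assumes h: "h \<equiv>\<^sub>t a @ pow_word g n @ b" "h \<equiv>\<^sub>t q @ r" and w: "is_word V h" "is_word V g"
    and g: "g \<noteq> []" "connected_on E (fst ` set g)" "dominating (fst ` set g)"
    and i: "i \<le> n" "card V - 1 \<le> i"
  shows "(\<forall>v. cnt v q \<le> cnt v (a @ pow_word g i)) \<or>
         (\<forall>v. cnt v (a @ pow_word g (i - (card V - 1))) \<le> cnt v q)"
proof -
  let ?S = "fst ` set g" and ?d = "card V - 1"
  let ?P = "\<lambda>k. a @ pow_word g k"
  have words: "is_word V (a @ pow_word g n @ b)" "is_word V q"
    using w teq_is_word[OF h(1)] teq_is_word[OF h(2)] by auto
  have SV: "?S \<subseteq> V" using w(2) by (auto simp: is_word_def)
  have S_ne: "card ?S > 0" using g(1) by (simp add: card_gt_0_iff)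
  have card_S: "card ?S \<le> card V" using finite_V SV by (rule card_mono)
  have hP: "h \<equiv>\<^sub>t ?P k @ pow_word g (n - k) @ b" if "k \<le> n" for k
    using h(1) pow_word_add[of g k "n - k"] that by simp
  have S_pos: "cnt v g > 0" if "v \<in> ?S" for v using that by (simp add: cnt_pos_iff)
  have spread: "cnt u (?P (k - m)) < cnt u q"
    if k: "k \<le> n" and v: "v \<in> ?S" "cnt v (?P k) < cnt v q" and m: "m \<le> k" "card ?S \<le> Suc m"
      and u: "u \<in> ?S" for k v m u
  proof -
    \<comment> \<open>The support vertices of which \<open>q\<close> holds more than
      \<open>a g^(k - m)\<close> does; raising \<open>m\<close> by one gives up one block.\<close>
    let ?B = "\<lambda>m. {v \<in> ?S. cnt v (?P (k - m)) < cnt v q}"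
    have "?B m = ?S"
    proof (rule connected_on_exhaust[where M = k and B = ?B])
      show "?B 0 \<noteq> {}" using v by auto
      show "?B l \<subseteq> ?B (Suc l)" for l
      proof -
        have "cnt x (?P (k - Suc l)) \<le> cnt x (?P (k - l))" for x
          by (simp add: mult_le_mono1 diff_le_mono2)
        then show ?thesis using le_less_trans by blast
      qed
      show "y \<in> ?B (Suc l)" if l: "l < k" and x: "x \<in> ?B l" and y: "y \<in> ?S" and "E x y" for l x y
      proof -
        \<comment> \<open>Dependence on \<open>x\<close> yields only a weak inequality for
          \<open>y\<close>; giving up one block, which contains \<open>y\<close>, makes it
          strict.\<close>
        have "k - l \<le> n" using k by simp
        then have "cnt y (?P (k - l)) \<le> cnt y q"
          using cnt_le_of_dependent[OF hP h(2) E_sym[OF \<open>E x y\<close>]] x by blast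
        moreover have "k - l = Suc (k - Suc l)" using l by simp
        ultimately show ?thesis using S_pos[OF y] y by simp
      qed
    qed (use g m in auto)
    then show ?thesis using u by blast
  qed
  show ?thesis
  proof (cases "\<forall>v. cnt v q \<le> cnt v (?P i)")
    case False
    then obtain v where v: "cnt v (?P i) < cnt v q" by (auto simp: not_le)
    then have "v \<in> fst ` set q" using cnt_pos_iff[of v q] by simp
    then have vV: "v \<in> V" using words(2) by (auto simp: is_word_def)
    have S: "cnt u (?P (i - ?d)) < cnt u q" if u: "u \<in> ?S" for u
    proof (cases "v \<in> ?S")
      case True
      then show ?thesis using spread[OF i(1) True v i(2) _ u] card_S by simp
    next
      case False
      \<comment> \<open>Passing from \<open>v\<close> to a neighbour in the support costs one block.
        This is affordable because the support now misses \<open>v\<close>, so that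
        \<open>card V - 2\<close> further blocks are enough to spread over it.\<close>
      then have "card ?S < card V" using SV vV finite_V by (intro psubset_card_mono) auto
      then have d: "Suc (card V - 2) = ?d" "card ?S \<le> ?d" using S_ne by auto
      obtain v' where v': "v' \<in> ?S" "E v v'"
        using g(3) vV False unfolding dominating_def by blast
      have i': "Suc (i - 1) = i" using i d by simp
      have "cnt v' (?P i) \<le> cnt v' q"
        using cnt_le_of_dependent[OF hP[OF i(1)] h(2) E_sym[OF v'(2)] v] .
      moreover have "cnt v' (?P i) = cnt v' g + cnt v' (?P (i - 1))"
        by (subst i'[symmetric]) simp
      ultimately have "cnt v' (?P (i - 1)) < cnt v' q" using S_pos[OF v'(1)] by simp
      then have "cnt u (?P (i - 1 - (card V - 2))) < cnt u q"
        using i d by (intro spread[OF _ v'(1) _ _ _ u]) auto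
      moreover have "i - 1 - (card V - 2) = i - ?d" using d by simp
      ultimately show ?thesis by simp
    qed
    have "cnt u (?P (i - ?d)) \<le> cnt u q" for u
    proof (cases "u \<in> V")
      case True
      show ?thesis
      proof (cases "u \<in> ?S")
        case False
        \<comment> \<open>A vertex outside the support inherits its bound from a neighbour inside,
          where the inequality is strict.\<close>
        then obtain v' where "v' \<in> ?S" "E u v'" using True g(3) unfolding dominating_def by blast
        moreover have "i - ?d \<le> n" using i by simp
        ultimately show ?thesis using cnt_le_of_dependent[OF hP h(2)] S by blast
      qed (use S in \<open>simp add: less_imp_le\<close>)
    next
      case False
      have "is_word V (?P (i - ?d))"
        using words(1) w(2) is_word_pow_word by simp
      then have "\<not> 0 < cnt u (?P (i - ?d))"
        unfolding cnt_pos_iff using False by (auto simp: is_word_def)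
      then show ?thesis by linarith
    qed
    then show ?thesis by blast
  qed simp
qed

text \<open>Otherwise \<open>q\<close> would contain \<open>a g^i\<close> by comparability. Since
  \<open>q\<close> is not longer, both would have the same counts, and \<open>q\<close> lies in the
  larger power all the same.\<close>

lemma short_prefix_of_power:
  assumes h: "h \<equiv>\<^sub>t a @ pow_word g n @ b" "h \<equiv>\<^sub>t q @ r" and w: "is_word V h" "is_word V g"
    and g: "g \<noteq> []" "connected_on E (fst ` set g)" "dominating (fst ` set g)"
    and i: "i + (card V - 1) \<le> n" and len: "length q \<le> length a + i * length g"
  obtains e where "a @ pow_word g (i + (card V - 1)) \<equiv>\<^sub>t q @ e"
proof -
  let ?k = "i + (card V - 1)"
  have words: "is_word V q" "is_word V a"
    using w teq_is_word[OF h(1)] teq_is_word[OF h(2)] by auto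
  have hk: "h \<equiv>\<^sub>t (a @ pow_word g ?k) @ pow_word g (n - ?k) @ b"
    using h(1) pow_word_add[of g ?k "n - ?k"] i by simp
  have "cnt v q \<le> cnt v (a @ pow_word g ?k)" for v
  proof (cases "\<forall>v. cnt v q \<le> cnt v (a @ pow_word g ?k)")
    case False
    then have le: "cnt v (a @ pow_word g i) \<le> cnt v q" for v
      using power_prefix_comparable[OF h w g i] by auto
    have "is_word V (a @ pow_word g i)" using words w is_word_pow_word by simp
    then have "(\<Sum>v\<in>V. cnt v q) \<le> (\<Sum>v\<in>V. cnt v (a @ pow_word g i))"
      using length_eq_sum_cnt[OF finite_V words(1)]
        length_eq_sum_cnt[OF finite_V, of "a @ pow_word g i"] len
      by simp
    then have "(\<Sum>v\<in>V. cnt v (a @ pow_word g i)) = (\<Sum>v\<in>V. cnt v q)"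
      using sum_mono[of V "\<lambda>v. cnt v (a @ pow_word g i)" "\<lambda>v. cnt v q"] le by simp
    then have "v \<in> V \<Longrightarrow> cnt v (a @ pow_word g i) = cnt v q"
      using sum_mono_inv[of "\<lambda>v. cnt v (a @ pow_word g i)" V "\<lambda>v. cnt v q"] le finite_V by blast
    moreover have "cnt v q = 0" if "v \<notin> V"
      using cnt_pos_iff[of v q] words(1) that by (auto simp: is_word_def)
    moreover have "cnt v (a @ pow_word g i) \<le> cnt v (a @ pow_word g ?k)" by simp
    ultimately show ?thesis by (cases "v \<in> V") auto
  qed simp
  then show ?thesis using tprefix_of_cnt_le[OF h(2) hk] that by blast
qed

section \<open>Commuting traces\<close>

text \<open>
  Proportional occurrence vectors are comparable, so one of two commuting traces is a prefix of the
  other and the Euclidean algorithm applies.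
\<close>

lemma commuting_common_root:
  assumes "x @ y \<equiv>\<^sub>t y @ x" and "\<And>a b. cnt a x * cnt b y = cnt a y * cnt b x"
  shows "\<exists>t p q. x \<equiv>\<^sub>t pow_word t p \<and> y \<equiv>\<^sub>t pow_word t q"
  using assms
proof (induction "length x + length y" arbitrary: x y rule: less_induct)
  case less
  \<comment> \<open>Stated for a fresh pair in order to serve both orders of the given traces;
    \<open>x'\<close> and \<open>y'\<close> carry the induction measure.\<close>
  have extend: "\<exists>t p q. x \<equiv>\<^sub>t pow_word t p \<and> y \<equiv>\<^sub>t pow_word t q"
    if comm: "x @ y \<equiv>\<^sub>t y @ x" and ratio: "\<And>a b. cnt a x * cnt b y = cnt a y * cnt b x"
      and le: "\<And>a. cnt a x \<le> cnt a y" and x: "x \<noteq> []"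
      and len: "length x + length y = length x' + length y'"
      and IH: "\<And>x y. length x + length y < length x' + length y' \<Longrightarrow> x @ y \<equiv>\<^sub>t y @ x \<Longrightarrow>
        (\<And>a b. cnt a x * cnt b y = cnt a y * cnt b x) \<Longrightarrow>
        \<exists>t p q. x \<equiv>\<^sub>t pow_word t p \<and> y \<equiv>\<^sub>t pow_word t q"
    for x y x' y' :: "'a word"
  proof -
    obtain e where e: "y \<equiv>\<^sub>t x @ e"
      using tprefix_of_cnt_le[OF teq_refl comm le] by blast
    have "x @ x @ e \<equiv>\<^sub>t x @ y" using e teq_sym by simp
    also have "\<dots> \<equiv>\<^sub>t y @ x" by (rule comm)
    also have "\<dots> \<equiv>\<^sub>t (x @ e) @ x" using e by (intro teq_append teq_refl)
    finally have "x @ e \<equiv>\<^sub>t e @ x" by simp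
    moreover have "cnt a x * cnt b e = cnt a e * cnt b x" for a b
      using ratio[of a b] teq_cnt[OF e] by (simp add: algebra_simps)
    moreover have "length x + length e < length x' + length y'"
      using teq_length[OF e] len x by (cases x) simp_all
    ultimately obtain t p q where "x \<equiv>\<^sub>t pow_word t p" "e \<equiv>\<^sub>t pow_word t q"
      using IH[of x e] by blast
    moreover from this have "x @ e \<equiv>\<^sub>t pow_word t (p + q)"
      by (simp add: pow_word_add teq_append)
    then have "y \<equiv>\<^sub>t pow_word t (p + q)" using e teq_trans by blast
    ultimately show ?thesis by blast
  qed
  have comparable: "(\<forall>a. cnt a x \<le> cnt a y) \<or> (\<forall>a. cnt a y \<le> cnt a x)"
  proof (rule ccontr)
    assume "\<not> ?thesis"
    then obtain a b where "cnt a y < cnt a x" "cnt b x < cnt b y" by (auto simp: not_le)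
    then have "cnt a y * cnt b x < cnt a x * cnt b y" by (intro mult_strict_mono) auto
    then show False using less.prems(2)[of a b] by simp
  qed
  consider "x = []" | "y = []" | "x \<noteq> []" "\<forall>a. cnt a x \<le> cnt a y"
    | "y \<noteq> []" "\<forall>a. cnt a y \<le> cnt a x" using comparable by blast
  then show ?case
  proof cases
    case 1
    then have "x \<equiv>\<^sub>t pow_word y 0" "y \<equiv>\<^sub>t pow_word y 1" by simp_all
    then show ?thesis by blast
  next
    case 2
    then have "x \<equiv>\<^sub>t pow_word x 1" "y \<equiv>\<^sub>t pow_word x 0" by simp_all
    then show ?thesis by blast
  next
    case 3
    show ?thesis
      by (rule extend[of x y x y]) (use 3 less in blast)+
  next
    case 4
    have "\<exists>t p q. y \<equiv>\<^sub>t pow_word t p \<and> x \<equiv>\<^sub>t pow_word t q"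
    proof (rule extend[of y x x y])
      show "y @ x \<equiv>\<^sub>t x @ y" using less.prems(1) by (rule teq_sym)
      show "cnt a y * cnt b x = cnt a x * cnt b y" for a b using less.prems(2)[of a b] by simp
    qed (use 4 less.hyps in \<open>auto simp: add.commute\<close>)
    then show ?thesis by blast
  qed
qed

text \<open>The projections to an edge are commuting words of a free monoid, hence powers of a
  common word \<open>z\<close>.\<close>

lemma commuting_cnt_dependent:
  assumes "x @ y \<equiv>\<^sub>t y @ x" and "E u v"
  shows "cnt u x * cnt v y = cnt u y * cnt v x"
proof -
  have "proj u v x @ proj u v y = proj u v y @ proj u v x"
    using assms by (simp add: teq_def)
  then obtain m n z where "concat (replicate m z) = proj u v x" "concat (replicate n z) = proj u v y"
    using comm_append_are_replicate by blast
  then have "proj u v x = pow_word z m" "proj u v y = pow_word z n"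
    by (simp_all add: pow_word_def)
  then have "cnt u x = m * cnt u z" "cnt v x = m * cnt v z"
    "cnt u y = n * cnt u z" "cnt v y = n * cnt v z"
    using cnt_proj[of u v x] cnt_proj[of v u x] cnt_proj[of u v y] cnt_proj[of v u y] by simp_all
  then show ?thesis by simp
qed

text \<open>The conclusion says that the pairs \<open>(cnt a x, cnt a y)\<close> are parallel. Edges
  give parallel pairs; this spreads over each connected support, passes between the supports by
  domination, and is trivial at vertices outside both.\<close>

lemma commuting_cnt_proportional:
  assumes comm: "x @ y \<equiv>\<^sub>t y @ x" and "y \<noteq> []" and "is_word V y"
    and conn: "connected_on E (fst ` set x)" "connected_on E (fst ` set y)"
    and "dominating (fst ` set x)"
  shows "cnt a x * cnt b y = cnt a y * cnt b x"
proof -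
  let ?R = "\<lambda>a b. cnt a x * cnt b y = cnt a y * cnt b x"
  let ?X = "fst ` set x" and ?Y = "fst ` set y"
  have sym: "?R a b \<Longrightarrow> ?R b a" for a b by (simp add: mult.commute)
  \<comment> \<open>Parallelism is transitive only through a nonzero pair, hence the condition on
    the middle vertex.\<close>
  have trans: "?R a c" if R: "?R a b" "?R b c" and b: "b \<in> ?X \<union> ?Y" for a b c
  proof -
    consider "cnt b x > 0" | "cnt b y > 0" using b by (auto simp: cnt_pos_iff)
    then show ?thesis
    proof cases
      case 1
      have "cnt b x * (cnt a x * cnt c y) = cnt a x * (cnt b x * cnt c y)" by simp
      also have "\<dots> = (cnt a x * cnt b y) * cnt c x" by (simp only: R(2) mult.assoc)
      also have "\<dots> = cnt b x * (cnt a y * cnt c x)" unfolding R(1) by simp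
      finally have "cnt b x * (cnt a x * cnt c y) = cnt b x * (cnt a y * cnt c x)" .
      then show ?thesis using 1 by simp
    next
      case 2
      have "cnt b y * (cnt a x * cnt c y) = (cnt a x * cnt b y) * cnt c y" by simp
      also have "\<dots> = cnt a y * (cnt b x * cnt c y)" by (simp only: R(1) mult.assoc)
      also have "\<dots> = cnt b y * (cnt a y * cnt c x)" unfolding R(2) by simp
      finally have "cnt b y * (cnt a x * cnt c y) = cnt b y * (cnt a y * cnt c x)" .
      then show ?thesis using 2 by simp
    qed
  qed
  have conn_R: "?R a b"
    if "connected_on E S" "S \<subseteq> ?X \<union> ?Y" "a \<in> S" "b \<in> S" for S a b
  proof -
    have "(\<lambda>a b. E a b \<and> a \<in> S \<and> b \<in> S)\<^sup>*\<^sup>* a b"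
      using that by (auto simp: connected_on_def)
    then show ?thesis
    proof (induction rule: rtranclp_induct)
      case base
      show ?case by simp
    next
      case (step b c)
      then have "?R b c" using commuting_cnt_dependent[OF comm] by blast
      then show ?case using trans[of a b c] step that(2) by blast
    qed
  qed
  obtain w where w: "w \<in> ?Y" using assms(2) by (cases y) auto
  then have "w \<in> V" using assms(3) by (auto simp: is_word_def)
  have "\<exists>u\<in>?X. ?R u w"
  proof (cases "w \<in> ?X")
    case True
    moreover have "?R w w" by simp
    ultimately show ?thesis by blast
  next
    case False
    then obtain u where "u \<in> ?X" "E w u" using \<open>w \<in> V\<close> assms(6) unfolding dominating_def by blast
    then show ?thesis using commuting_cnt_dependent[OF comm] sym by blast
  qed
  then obtain u where u: "u \<in> ?X" "?R u w" by blast
  have XY: "?R a b" if "a \<in> ?X" "b \<in> ?Y" for a b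
  proof -
    have "?R a w" using trans[of a u w] conn_R[OF conn(1) _ that(1) u(1)] u by blast
    then show ?thesis using trans[of a w b] conn_R[OF conn(2) _ w that(2)] w by blast
  qed
  have zero: "?R a b" if "a \<notin> ?X \<union> ?Y" for a b
    using that cnt_pos_iff[of a x] cnt_pos_iff[of a y] by simp
  consider "a \<notin> ?X \<union> ?Y" | "b \<notin> ?X \<union> ?Y" | "a \<in> ?X" "b \<in> ?X" | "a \<in> ?Y" "b \<in> ?Y"
    | "a \<in> ?X" "b \<in> ?Y" | "a \<in> ?Y" "b \<in> ?X" by blast
  then show ?thesis
  proof cases
    case 1 then show ?thesis by (rule zero)
  next
    case 2 then show ?thesis using zero sym by blast
  next
    case 3 then show ?thesis using conn_R[OF conn(1)] by blast
  next
    case 4 then show ?thesis using conn_R[OF conn(2)] by blast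
  next
    case 5 then show ?thesis by (rule XY)
  next
    case 6 then show ?thesis using XY sym by blast
  qed
qed

section \<open>Overlapping powers\<close>

text \<open>The trace \<open>g\<close> stands for \<open>c^-1 g1 c\<close>. The bound
  \<open>overlap\<close> is required for both block lengths because comparing prefixes costs up to
  \<open>card V - 1\<close> blocks of either power.\<close>

lemma overlapping_powers_commute:
  assumes h: "h \<equiv>\<^sub>t a1 @ pow_word g1 n1 @ b1" "h \<equiv>\<^sub>t a2 @ pow_word g2 n2 @ b2" and w: "is_word V h"
    and w1: "is_word V g1" and w2: "is_word V g2"
    and g1: "g1 \<noteq> []" "connected_on E (fst ` set g1)" "dominating (fst ` set g1)"
    and g2: "g2 \<noteq> []" "connected_on E (fst ` set g2)" "dominating (fst ` set g2)"
    and overlap: "\<And>a g. a \<in> {a1, a2} \<Longrightarrow> g \<in> {g1, g2} \<Longrightarrow>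
        length a + (2 * card V + 1) * length g \<le> length a1 + n1 * length g1 \<and>
        length a + (2 * card V + 1) * length g \<le> length a2 + n2 * length g2"
  obtains c g j where "a1 @ c \<equiv>\<^sub>t a2 @ pow_word g2 j" "g1 @ c \<equiv>\<^sub>t c @ g" "g @ g2 \<equiv>\<^sub>t g2 @ g"
proof -
  define d where "d = card V - 1"
  have "V \<noteq> {}" using w1 g1(1) by (cases g1) auto
  then have card_V: "card V = Suc d" using finite_V by (simp add: d_def card_gt_0_iff)
  define M where "M = max (length a1) (length a2)"
  have ov: "M + (2 * d + 3) * length g \<le> length a1 + n1 * length g1"
    "M + (2 * d + 3) * length g \<le> length a2 + n2 * length g2" if "g \<in> {g1, g2}" for g
    using overlap[of a1 g] overlap[of a2 g] that unfolding M_def card_V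
    by (auto simp: max_def algebra_simps)
  define G where "G = max (length g1) (length g2)"
  have G: "M + (2 * d + 3) * G \<le> length a1 + n1 * length g1"
    "M + (2 * d + 3) * G \<le> length a2 + n2 * length g2"
    using ov[of g1] ov[of g2] by (auto simp: G_def max_def)
  have gG: "length g1 \<le> G" "length g2 \<le> G" by (auto simp: G_def)
  \<comment> \<open>The first power for which \<open>a2 g2^t\<close> is at least as long as
    \<open>a1\<close>; minimality bounds the overshoot by one block.\<close>
  define t where "t = (LEAST t. length a1 \<le> length a2 + t * length g2)"
  have "length a1 \<le> length a2 + n2 * length g2" using ov(2)[of g2] by (simp add: M_def)
  then have t: "length a1 \<le> length a2 + t * length g2"
    unfolding t_def by (rule LeastI)
  have t_le: "length a2 + t * length g2 \<le> M + length g2"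
  proof (cases t)
    case (Suc s)
    then have "\<not> length a1 \<le> length a2 + s * length g2"
      using not_less_Least[of s "\<lambda>t. length a1 \<le> length a2 + t * length g2"]
      by (simp flip: t_def)
    then show ?thesis using Suc by (simp add: M_def)
  qed (simp add: M_def)
  have "(t + 2 * d + 2) * length g2 \<le> n2 * length g2"
    using t_le ov(2)[of g2] by (simp add: algebra_simps)
  then have n2: "t + 2 * d + 2 \<le> n2" using g2(1) mult_le_cancel2[of "t + 2 * d + 2" "length g2" n2] by blast
  have "length a1 \<le> M" by (simp add: M_def)
  then have "(2 * d + 3) * length g1 \<le> n1 * length g1"
    using ov(1)[OF insertI1] by linarith
  then have "2 * d + 3 \<le> n1" using g1(1) mult_le_cancel2[of "2 * d + 3" "length g1" n1] by blast
  \<comment> \<open>Of the blocks, \<open>d\<close> are spent on comparing prefixes and one is split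
    off at the front; the same reserve is made for \<open>g2\<close>.\<close>
  then obtain m1 where m1: "n1 = m1 + d + 1" using le_iff_add[of "d + 1" n1] by auto
  obtain m2 where m2: "n2 = m2 + d + 1" using n2 le_iff_add[of "d + 1" n2] by auto
  \<comment> \<open>After \<open>d\<close> more blocks the power contains \<open>a1\<close> as a
    prefix and is not merely as long.\<close>
  define j where "j = t + d"
  let ?Q = "\<lambda>j. a2 @ pow_word g2 j"
  have dG: "k * length g1 + l * length g2 \<le> (k + l) * G" for k l
    using gG by (simp add: add_mult_distrib add_mono mult_le_mono2)
  have hQ: "h \<equiv>\<^sub>t ?Q k @ pow_word g2 (n2 - k) @ b2" if "k \<le> n2" for k
    using h(2) pow_word_add[of g2 k "n2 - k"] that by simp

  obtain c where c: "?Q j \<equiv>\<^sub>t a1 @ c"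
    using short_prefix_of_power[OF h(2,1) w w2 g2, of t] t n2 by (auto simp: j_def d_def)
  have len_j: "length (?Q j) \<le> M + (d + 1) * length g2"
    using t_le by (simp add: j_def algebra_simps)

  \<comment> \<open>Beyond \<open>M\<close> this takes at most \<open>d + 2\<close> blocks of
    \<open>g2\<close>, and \<open>d + 1\<close> blocks of \<open>g1\<close> are reserved:
    \<open>2 * d + 3 = 2 * card V + 1\<close> in all, exactly the given overlap.\<close>
  have "length (?Q (j + 1)) \<le> length a1 + m1 * length g1"
    using len_j dG[of "d + 1" "d + 2"] G(1) by (simp add: m1 algebra_simps)
  moreover have "j + 1 \<le> n2" using n2 by (simp add: j_def)
  ultimately obtain f where "a1 @ pow_word g1 (m1 + d) \<equiv>\<^sub>t ?Q (j + 1) @ f"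
    using short_prefix_of_power[OF h(1) hQ[of "j + 1"] w w1 g1, of m1] by (auto simp: m1 d_def)
  also have "?Q (j + 1) @ f = ?Q j @ g2 @ f" by (simp add: pow_word_comm[symmetric])
  also have "\<dots> \<equiv>\<^sub>t (a1 @ c) @ g2 @ f" by (rule teq_append[OF c teq_refl])
  finally have f: "pow_word g1 (m1 + d) \<equiv>\<^sub>t c @ g2 @ f" by simp
  \<comment> \<open>One block \<open>g1\<close> is split off and the others are rewritten through
    \<open>f\<close>, so \<open>a1 g1 c\<close> is a prefix of \<open>h\<close> as well, again
    followed by \<open>g2\<close>.\<close>
  have hc: "h \<equiv>\<^sub>t (a1 @ g1 @ c) @ g2 @ f @ b1"
  proof -
    have "h \<equiv>\<^sub>t (a1 @ g1) @ pow_word g1 (m1 + d) @ b1" using h(1) by (simp add: m1)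
    also have "\<dots> \<equiv>\<^sub>t (a1 @ g1) @ (c @ g2 @ f) @ b1"
      using f by (intro teq_append teq_refl)
    finally show ?thesis by simp
  qed

  \<comment> \<open>Since \<open>?Q j\<close> is \<open>a1 c\<close>, it has no more occurrences
    than the prefix \<open>a1 g1 c\<close> and divides it; the quotient is \<open>g\<close>.\<close>
  have "cnt v (?Q j) \<le> cnt v (a1 @ g1 @ c)" for v using teq_cnt[OF c, of v] by simp
  then obtain g where "a1 @ g1 @ c \<equiv>\<^sub>t ?Q j @ g"
    using tprefix_of_cnt_le[OF hQ[of j] hc] n2 by (auto simp: j_def)
  also have "\<dots> \<equiv>\<^sub>t (a1 @ c) @ g" by (rule teq_append[OF c teq_refl])
  finally have g: "g1 @ c \<equiv>\<^sub>t c @ g" by simp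

  have "length (a1 @ g1 @ c) \<le> length a2 + m2 * length g2"
    using len_j teq_length[OF c] dG[of 1 "2 * d + 2"] G(2) by (simp add: m2 algebra_simps)
  then obtain f' where "?Q (m2 + d) \<equiv>\<^sub>t (a1 @ g1 @ c) @ f'"
    using short_prefix_of_power[OF h(2) hc w w2 g2, of m2] by (auto simp: m2 d_def)
  also have "(a1 @ g1 @ c) @ f' = a1 @ (g1 @ c) @ f'" by simp
  also have "\<dots> \<equiv>\<^sub>t a1 @ (c @ g) @ f'"
    by (rule teq_append[OF teq_refl teq_append[OF g teq_refl]])
  also have "\<dots> = (a1 @ c) @ g @ f'" by simp
  also have "\<dots> \<equiv>\<^sub>t ?Q j @ g @ f'" by (rule teq_append[OF teq_sym[OF c] teq_refl])
  finally have f': "pow_word g2 (m2 + d) \<equiv>\<^sub>t pow_word g2 j @ g @ f'" by simp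

  \<comment> \<open>Two factorisations of \<open>h\<close> are compared: through \<open>hc\<close>
    the prefix \<open>?Q j\<close> is followed by \<open>g g2\<close>, and after splitting off a
    first block \<open>g2\<close> it is followed by \<open>g2 g\<close>.\<close>
  have "?Q j @ g @ g2 @ f @ b1 \<equiv>\<^sub>t (a1 @ c) @ g @ g2 @ f @ b1"
    by (rule teq_append[OF c teq_refl])
  also have "\<dots> = a1 @ (c @ g) @ g2 @ f @ b1" by simp
  also have "\<dots> \<equiv>\<^sub>t a1 @ (g1 @ c) @ g2 @ f @ b1"
    by (rule teq_append[OF teq_refl teq_append[OF teq_sym[OF g] teq_refl]])
  also have "\<dots> \<equiv>\<^sub>t h" using teq_sym[OF hc] by simp
  also have "h \<equiv>\<^sub>t (a2 @ g2) @ pow_word g2 (m2 + d) @ b2" using h(2) by (simp add: m2)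
  also have "\<dots> \<equiv>\<^sub>t (a2 @ g2) @ (pow_word g2 j @ g @ f') @ b2"
    using f' by (intro teq_append teq_refl)
  also have "\<dots> = a2 @ (g2 @ pow_word g2 j) @ g @ f' @ b2" by simp
  also have "\<dots> = ?Q j @ g2 @ g @ f' @ b2" by (simp add: pow_word_comm[symmetric])
  finally have "(g @ g2) @ f @ b1 \<equiv>\<^sub>t (g2 @ g) @ f' @ b2" by simp
  then have "g @ g2 \<equiv>\<^sub>t g2 @ g" by (rule teq_of_cnt_eq) simp
  then show ?thesis using that[of c j g] teq_sym[OF c] g by blast
qed

section \<open>Conjugation identities in the group\<close>

lemma geq_conj_transport:
  assumes "a @ c \<approx> q" and "g @ c \<approx> c @ g'"
  shows "(a @ g @ inv_word a) @ q \<approx> q @ g'"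
proof -
  have "(a @ g @ inv_word a) @ q \<approx> (a @ g @ inv_word a) @ (a @ c)"
    using geq_sym[OF assms(1)] by (rule geq_append[OF geq_refl])
  also have "\<dots> = ((a @ g @ inv_word a) @ a) @ c" by simp
  also have "\<dots> \<approx> (a @ g) @ c" by (rule geq_append[OF geq_conj_right geq_refl])
  also have "\<dots> = a @ (g @ c)" by simp
  also have "\<dots> \<approx> a @ (c @ g')" using assms(2) by (rule geq_append[OF geq_refl])
  also have "\<dots> = (a @ c) @ g'" by simp
  also have "\<dots> \<approx> q @ g'" using assms(1) by (rule geq_append[OF _ geq_refl])
  finally show ?thesis .
qed

text \<open>As \<open>g\<close> commutes with its power, \<open>h\<close> carries the conjugate of
  \<open>g\<close> at \<open>b\<close> to the one at \<open>a\<close>. The claim on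
  \<open>b1\<close> and \<open>b2\<close> thus reduces to that on \<open>a1\<close> and
  \<open>a2\<close>.\<close>

lemma geq_conj_swap:
  assumes "h \<approx> a @ pow_word g n @ b"
  shows "h @ (inv_word b @ g @ b) \<approx> (a @ g @ inv_word a) @ h"
proof -
  have "h @ (inv_word b @ g @ b) \<approx> (a @ pow_word g n @ b) @ (inv_word b @ g @ b)"
    using assms by (rule geq_append[OF _ geq_refl])
  also have "\<dots> = (a @ pow_word g n) @ (b @ inv_word b @ g @ b)" by simp
  also have "\<dots> \<approx> (a @ pow_word g n) @ (g @ b)" by (rule geq_append[OF geq_refl geq_conj_left])
  also have "\<dots> = a @ (pow_word g n @ g) @ b" by simp
  also have "\<dots> = (a @ g) @ pow_word g n @ b" by (simp add: pow_word_comm)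
  also have "\<dots> \<approx> ((a @ g @ inv_word a) @ a) @ pow_word g n @ b"
    by (rule geq_append[OF geq_sym[OF geq_conj_right] geq_refl])
  also have "\<dots> = (a @ g @ inv_word a) @ (a @ pow_word g n @ b)" by simp
  also have "\<dots> \<approx> (a @ g @ inv_word a) @ h"
    using geq_sym[OF assms] by (rule geq_append[OF geq_refl])
  finally show ?thesis .
qed

lemma geq_conj_cong:
  assumes "a \<approx> a'" and "g \<approx> g'"
  shows "a @ g @ inv_word a \<approx> a' @ g' @ inv_word a'"
proof (rule geq_cancel_right)
  have "(a @ g @ inv_word a) @ a \<approx> a @ g" by (rule geq_conj_right)
  also have "\<dots> \<approx> a' @ g'" using assms by (rule geq_append)
  also have "\<dots> \<approx> (a' @ g' @ inv_word a') @ a'" using geq_conj_right by (rule geq_sym)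
  also have "\<dots> \<approx> (a' @ g' @ inv_word a') @ a"
    using geq_sym[OF assms(1)] by (rule geq_append[OF geq_refl])
  finally show "(a @ g @ inv_word a) @ a \<approx> (a' @ g' @ inv_word a') @ a" .
qed

section \<open>The hypotheses in terms of reduced words\<close>

lemma primitive_geq_pow_word:
  assumes "primitive V E g" and "is_word V u" and "g \<approx> pow_word u n"
  shows "n = 1"
proof (rule ccontr)
  assume "n \<noteq> 1"
  then consider "n = 0" | "n \<ge> 2" by linarith
  then show False using assms by cases (auto simp: primitive_def)
qed

lemma strongly_non_split_support:
  assumes "strongly_non_split V E g" and "reduced V E g'" and "g \<approx> g'"
  shows "connected_on E (fst ` set g')" and "dominating (fst ` set g')"
proof -
  have supp: "supp V E g = fst ` set g'" using assms(2,3) by (rule supp_reduced)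
  then show "connected_on E (fst ` set g')"
    using assms(1) by (simp add: strongly_non_split_def non_split_def)
  have single: "supp V E [(v, True)] \<subseteq> {v}" for v using supp_subset[of "[(v, True)]"] by simp
  show "dominating (fst ` set g')"
    unfolding dominating_def
  proof
    fix v assume "v \<in> V"
    then have "\<not> disj_commute V E [(v, True)] g"
      using assms(1) by (simp add: strongly_non_split_def)
    then show "v \<in> fst ` set g' \<or> (\<exists>u\<in>fst ` set g'. E v u)"
      using single[of v] unfolding disj_commute_def supp by blast
  qed
qed

text \<open>Each factor is replaced by a shortest word. The lengths add up to that of
  \<open>h\<close> because the decomposition is geodesic, so the concatenation is itself
  reduced.\<close>

lemma quasi_root_decomp_reduced:
  assumes "quasi_root_decomp V E lam N h a g n b"
  obtains a' g' b' where "a \<approx> a'" "g \<approx> g'" "h \<approx> a' @ pow_word g' n @ b'"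
    "reduced V E g'" "reduced V E (a' @ pow_word g' n @ b')"
    "length a' = wlen V E a" "length b' = wlen V E b"
    "wlen V E h = length a' + n * length g' + length b'"
proof -
  note q = assms[unfolded quasi_root_decomp_def]
  obtain a' where a: "is_word V a'" "a \<approx> a'" "length a' = wlen V E a" using q ex_reduced by blast
  obtain g' where g: "is_word V g'" "g \<approx> g'" "length g' = wlen V E g" using q ex_reduced by blast
  obtain b' where b: "is_word V b'" "b \<approx> b'" "length b' = wlen V E b" using q ex_reduced by blast
  have "a @ pow_word g n @ b \<approx> a' @ pow_word g' n @ b'"
    using a g b by (intro geq_append geq_pow_word)
  then have h: "h \<approx> a' @ pow_word g' n @ b'" using q geq_trans by blast
  have len: "wlen V E h = length a' + n * length g' + length b'" using q a g b by simp
  have "reduced V E g'" using g wlen_cong[OF g(2)] by (simp add: reduced_def)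
  moreover have "reduced V E (a' @ pow_word g' n @ b')"
    using a g b len wlen_cong[OF h] by (simp add: reduced_def is_word_pow_word)
  ultimately show ?thesis using that a(2,3) g(2) b(3) h len by blast
qed

end


text \<open>Here \<open>l\<close> is the length of a root and \<open>k\<close> the number of
  vertices: what remains of \<open>h\<close> after two ends of length \<open>lam * L\<close> has
  room for \<open>2 * k + 1\<close> roots.\<close>

lemma quasi_root_length:
  fixes lam :: real and k N n :: nat
  assumes "lam < 1/2" and "real N \<ge> (2 * real k + 1) / (1 - 2 * lam)" and "N \<le> n" and "n * l \<le> L"
  shows "(2 * real k + 1) * real l \<le> (1 - 2 * lam) * real L"
proof -
  have pos: "1 - 2 * lam > 0" using assms(1) by simp
  have "2 * real k + 1 \<le> (1 - 2 * lam) * real N"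
    using assms(2) pos by (simp add: pos_divide_le_eq mult.commute)
  then have "(2 * real k + 1) * real l \<le> (1 - 2 * lam) * real N * real l"
    by (intro mult_right_mono) auto
  also have "\<dots> = (1 - 2 * lam) * real (N * l)" by simp
  also have "\<dots> \<le> (1 - 2 * lam) * real L"
    using pos assms(3,4) le_trans[OF mult_le_mono1[OF assms(3)] assms(4)]
    by (intro mult_left_mono) (auto simp del: of_nat_mult)
  finally show ?thesis .
qed

theorem theorem1p9:
  fixes V :: "'a set" and E :: "'a \<Rightarrow> 'a \<Rightarrow> bool" and lam :: real and N :: nat
    and h a1 g1 b1 a2 g2 b2 :: "'a word" and n1 n2 :: nat
  assumes "simple_graph V E" and "connected_on E V"
    and "0 \<le> lam" and "lam < 1/2"
    and "real N \<ge> (2 * real (card V) + 1) / (1 - 2 * lam)"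
    and "is_word V h"
    and "quasi_root_decomp V E lam N h a1 g1 n1 b1"
    and "quasi_root_decomp V E lam N h a2 g2 n2 b2"
    and "strongly_non_split V E g1" and "primitive V E g1"
    and "strongly_non_split V E g2" and "primitive V E g2"
  shows "raag_eq E (a1 @ g1 @ inv_word a1) (a2 @ g2 @ inv_word a2)
       \<and> raag_eq E (inv_word b1 @ g1 @ b1) (inv_word b2 @ g2 @ b2)"
proof -
  interpret raag_graph V E using assms(1) by unfold_locales
  note q1 = assms(7)[unfolded quasi_root_decomp_def] and q2 = assms(8)[unfolded quasi_root_decomp_def]
  obtain A1 G1 B1 where 1: "a1 \<approx> A1" "g1 \<approx> G1" "h \<approx> A1 @ pow_word G1 n1 @ B1"
    "reduced V E G1" "reduced V E (A1 @ pow_word G1 n1 @ B1)"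
    "length A1 = wlen V E a1" "length B1 = wlen V E b1"
    "wlen V E h = length A1 + n1 * length G1 + length B1"
    using assms(7) by (rule quasi_root_decomp_reduced)
  obtain A2 G2 B2 where 2: "a2 \<approx> A2" "g2 \<approx> G2" "h \<approx> A2 @ pow_word G2 n2 @ B2"
    "reduced V E G2" "reduced V E (A2 @ pow_word G2 n2 @ B2)"
    "length A2 = wlen V E a2" "length B2 = wlen V E b2"
    "wlen V E h = length A2 + n2 * length G2 + length B2"
    using assms(8) by (rule quasi_root_decomp_reduced)
  \<comment> \<open>One trace carrying both decompositions, whose reduced words represent the same
    element.\<close>
  define H where "H = A1 @ pow_word G1 n1 @ B1"
  have H: "H \<equiv>\<^sub>t A1 @ pow_word G1 n1 @ B1" "H \<equiv>\<^sub>t A2 @ pow_word G2 n2 @ B2"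
    unfolding H_def
    by (rule teq_refl) (rule reduced_teq[OF 1(5) 2(5) geq_trans[OF geq_sym[OF 1(3)] 2(3)]])
  have words: "is_word V H" "is_word V G1" "is_word V G2"
    using 1(4,5) 2(4) by (auto simp: reduced_def H_def)
  have ne: "G1 \<noteq> []" "G2 \<noteq> []"
    using assms(10,12) 1(2) 2(2) by (auto simp: primitive_def)
  let ?L = "wlen V E h"
  have gl: "(2 * real (card V) + 1) * real (length G) \<le> (1 - 2 * lam) * real ?L"
    if "G \<in> {G1, G2}" for G
    using that quasi_root_length[OF assms(4,5), of n1 "length G1" ?L]
      quasi_root_length[OF assms(4,5), of n2 "length G2" ?L] q1 q2 1(8) 2(8) by auto
  have bounds: "real (length A1) \<le> lam * real ?L" "real (length B1) \<le> lam * real ?L"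
    "real (length A2) \<le> lam * real ?L" "real (length B2) \<le> lam * real ?L"
    unfolding 1(6,7) 2(6,7) using q1 q2 by blast+
  have al: "real (length A) \<le> lam * real ?L" if "A \<in> {A1, A2}" for A
    using that bounds by blast
  have real_overlap: "real (length A + (2 * card V + 1) * length G) \<le> real (length A1 + n1 * length G1)"
    "real (length A + (2 * card V + 1) * length G) \<le> real (length A2 + n2 * length G2)"
    if "A \<in> {A1, A2}" "G \<in> {G1, G2}" for A G
  proof -
    have "real ?L = real (length A1 + n1 * length G1) + real (length B1)"
      "real ?L = real (length A2 + n2 * length G2) + real (length B2)"
      using 1(8) 2(8) by (metis of_nat_add)+
    moreover have "(1 - 2 * lam) * real ?L = real ?L - 2 * (lam * real ?L)"
      by (simp add: algebra_simps)
    moreover have "real (length A + (2 * card V + 1) * length G) =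
      real (length A) + (2 * real (card V) + 1) * real (length G)" by (simp add: distrib_right)
    ultimately show "real (length A + (2 * card V + 1) * length G) \<le> real (length A1 + n1 * length G1)"
      "real (length A + (2 * card V + 1) * length G) \<le> real (length A2 + n2 * length G2)"
      using gl[OF that(2)] al[OF that(1)] bounds by linarith+
  qed
  have overlap: "length A + (2 * card V + 1) * length G \<le> length A1 + n1 * length G1 \<and>
      length A + (2 * card V + 1) * length G \<le> length A2 + n2 * length G2"
    if "A \<in> {A1, A2}" "G \<in> {G1, G2}" for A G
    using real_overlap[OF that] by (simp only: of_nat_le_iff)
  note s1 = strongly_non_split_support[OF assms(9) 1(4,2)]
    and s2 = strongly_non_split_support[OF assms(11) 2(4,2)]
  obtain c g j where cg: "A1 @ c \<equiv>\<^sub>t A2 @ pow_word G2 j" "G1 @ c \<equiv>\<^sub>t c @ g" "g @ G2 \<equiv>\<^sub>t G2 @ g"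
    using overlapping_powers_commute[OF H words ne(1) s1 ne(2) s2 overlap] by blast
  \<comment> \<open>Conjugation of traces preserves counts, so \<open>g\<close> inherits the
    connected dominating support of \<open>G1\<close>.\<close>
  have "cnt v g = cnt v G1" for v using teq_cnt[OF cg(2), of v] by simp
  then have "v \<in> fst ` set g \<longleftrightarrow> v \<in> fst ` set G1" for v by (simp flip: cnt_pos_iff)
  then have supp_g: "fst ` set g = fst ` set G1" by blast
  obtain t p q where t: "g \<equiv>\<^sub>t pow_word t p" "G2 \<equiv>\<^sub>t pow_word t q"
    using commuting_common_root[OF cg(3) commuting_cnt_proportional[OF cg(3) ne(2) words(3)]]
      s1 s2 supp_g by auto
  have wt: "is_word V t"
  proof (cases q)
    case 0
    then show ?thesis using t(2) ne(2) teq_Nil_iff by simp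
  next
    case (Suc k)
    then show ?thesis using teq_is_word[OF t(2)] words(3) by simp
  qed
  have wc: "is_word V c"
    using teq_is_word[OF cg(1)] 2(5) is_word_pow_word[OF words(3), of j] by (simp add: reduced_def)
  have q: "q = 1"
    using geq_trans[OF 2(2) teq_imp_geq[OF t(2)]] assms(12) wt by (intro primitive_geq_pow_word)
  \<comment> \<open>Primitivity is known for \<open>g1\<close> and not for \<open>g\<close>, so the
    power is carried back: \<open>G1\<close> is the \<open>p\<close>-th power of
    \<open>c t c^-1\<close>.\<close>
  have "G1 @ c \<approx> c @ pow_word t p"
    using teq_imp_geq[OF cg(2)] geq_append[OF geq_refl teq_imp_geq[OF t(1)]] by (rule geq_trans)
  also have "\<dots> \<approx> pow_word (c @ t @ inv_word c) p @ c" using geq_conj_pow_word by (rule geq_sym)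
  finally have "G1 \<approx> pow_word (c @ t @ inv_word c) p" by (rule geq_cancel_right)
  then have p: "p = 1"
    using assms(10) wt wc geq_trans[OF 1(2)]
    by (intro primitive_geq_pow_word[of g1 "c @ t @ inv_word c"]) auto
  have "g \<equiv>\<^sub>t G2" using t(1) teq_sym[OF t(2)] unfolding p q by (rule teq_trans)
  then have "c @ g \<equiv>\<^sub>t c @ G2" by simp
  then have G1c: "G1 @ c \<equiv>\<^sub>t c @ G2" using cg(2) teq_trans by blast
  let ?x1 = "a1 @ g1 @ inv_word a1" and ?x2 = "a2 @ g2 @ inv_word a2"
  let ?Q = "A2 @ pow_word G2 j"
  \<comment> \<open>Both conjugates are evaluated on the common prefix \<open>?Q\<close>; each turns
    it into \<open>?Q G2\<close>, and right cancellation identifies them.\<close>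
  have Q1: "(A1 @ G1 @ inv_word A1) @ ?Q \<approx> ?Q @ G2"
    using cg(1) G1c by (intro geq_conj_transport teq_imp_geq)
  have Q2: "(A2 @ G2 @ inv_word A2) @ ?Q \<approx> ?Q @ G2"
    by (intro geq_conj_transport[where c = "pow_word G2 j"]) (simp_all add: pow_word_comm)
  have "A1 @ G1 @ inv_word A1 \<approx> A2 @ G2 @ inv_word A2"
    using Q1 geq_sym[OF Q2] by (rule geq_cancel_right[OF geq_trans])
  then have x: "?x1 \<approx> ?x2"
    using geq_trans[OF geq_conj_cong[OF 1(1,2)] geq_trans[OF _ geq_sym[OF geq_conj_cong[OF 2(1,2)]]]]
    by blast
  have h: "h \<approx> a1 @ pow_word g1 n1 @ b1" "h \<approx> a2 @ pow_word g2 n2 @ b2"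
    using q1 q2 by auto
  have "h @ (inv_word b1 @ g1 @ b1) \<approx> ?x1 @ h" using h(1) by (rule geq_conj_swap)
  also have "\<dots> \<approx> ?x2 @ h" using x by (rule geq_append[OF _ geq_refl])
  also have "\<dots> \<approx> h @ (inv_word b2 @ g2 @ b2)" using geq_conj_swap[OF h(2)] by (rule geq_sym)
  finally have "inv_word b1 @ g1 @ b1 \<approx> inv_word b2 @ g2 @ b2" by (rule geq_cancel_left)
  with x show ?thesis by blast
qed

end
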